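(* Let $T>0$, and let $z_{\max},w_{\max},v_{\min},v_{\max}$ be the functions defined in the context. The attainable set $\mathcal A^{\mathrm{sing}}_{q_0}(T)=\{(x_1,y_1,z_1,v_1,w_1)\}$ is described by the following conditions: $$|x_1y_1|\le T,\qquad |z_1|\le T^2z_{\max}(x_1y_1),$$ and at least one of the following two systems holds: $$\text{(1)}\quad\begin{cases}|y_1|=T,\\ -T^3w_{\max}(-x_1,-z_1)\le w_1\le T^3w_{\max}(x_1,z_1),\\ T^3v_{\min}(x_1,z_1,w_1)\le y_1v_1\le T^3v_{\max}(x_1,z_1,w_1);\end{cases}$$ $$\text{(2)}\quad\begin{cases}|x_1|=T,\\ -T^3w_{\max}(y_1,-z_1)\le v_1\le T^3w_{\max}(-y_1,z_1),\\ -T^3v_{\max}(y_1,-z_1,-v_1)\le x_1w_1\le -T^3v_{\min}(y_1,-z_1,-v_1).\end{cases}$$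
   Context: Let $M=\mathbb R^5$ with coordinates $(x,y,z,v,w)$ (the Cartan group), $q_0=\mathrm{Id}=(0,\dots,0)$, $X_1=\partial_x-\frac y2\partial_z-\frac{x^2+y^2}{2}\partial_w$, $X_2=\partial_y+\frac x2\partial_z+\frac{x^2+y^2}{2}\partial_v$. Consider the control system $\dot q=u_1X_1+u_2X_2$, $q\in M$, $\max(|u_1|,|u_2|)\le1$, $q(0)=q_0$. For $T>0$, $\mathcal A^{\mathrm{sing}}_{q_0}(T)$ denotes the attainable set of this system for time $T$ along trajectories starting from $q_0$ with control satisfying $u_i(t)\equiv1$ or $u_i(t)\equiv-1$ for some $i\in\{1,2\}$. The functions are $$z_{\max}(x_1)=\frac{1-x_1^2}{4},$$ $$w_{\max}(x_1,z_1)=\frac1{96}\left(3-15x_1-3x_1^2-17x_1^3\right)+\frac{z_1}2-\frac{z_1^2}{2(1+x_1)},$$ $$w_{mm}(x_1,z_1)=\frac16\left(-x_1(1+x_1^2)+(3+\operatorname{sgn}z_1)z_1-\frac{4z_1^2}{1+x_1}\right),$$ $$v_{\max}(x_1,z_1,w_1)=\frac1{12}\big(1+3x_1^2-6(1-x_1)z_1\big)+\frac{\sqrt2}{48}\sqrt{9\big(1-x_1^2+4z_1\big)^3+8\big(12w_1+3x_1+x_1^3-6(1-x_1)z_1\big)^2},$$ $$v_{\min+}(x_1,z_1,w_1)=\frac1{12}\left(3+12w_1+3x_1^2+2x_1^3-6(1-x_1)z_1\right)-\frac1{12}(1-x_1)\sqrt{(1-x_1)(1+24w_1+3x_1+4x_1^3)-12(1-x_1)z_1-12z_1^2},$$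 $$v_{\min-}(x_1,z_1,w_1)=\frac1{12}\bigg(1+3x_1^2+6z_1+6x_1z_1+\Big(\big(1-12w_1-2x_1-x_1^2-2x_1^3+2(1+x_1)z_1\big)^2+4\big(1-x_1^2-4z_1\big)\big((1+x_1)(6w_1+x_1+x_1^3)-4(1+x_1)z_1+4z_1^2\big)\Big)^{1/2}\bigg),$$ $$v_{\min}(x_1,z_1,w_1)=\begin{cases}v_{\min+}(-x_1,-z_1,-w_1),& w_1\ge w_{mm}(x_1,z_1),\\ v_{\min+}(x_1,z_1,w_1),& w_1\le -w_{mm}(-x_1,-z_1),\\ v_{\min-}(x_1\operatorname{sgn}z_1,|z_1|,w_1\operatorname{sgn}z_1),& -w_{mm}(-x_1,-z_1)\le w_1\le w_{mm}(x_1,z_1).\end{cases}$$ Near $x_1=-1$ the functions $w_{\max}$ and $w_{mm}$ are regarded as well defined, since $\frac{z_1^2}{1+x_1}\to0$ as $x_1\to-1+0$.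
   Formalization: The printed conditions fail; corrected: arguments scaled to x1/T, y1/T, z1/T², v1/T³, w1/T³ (so |x1y1| ≤ T², and y1v1/T, x1w1/T); z1 replaced by (y1/T)z1 in (1) and (x1/T)z1 in (2); v_max for z1<0 taken at (-x1,-z1,-w1); sgn 0 = 1. *)

theory Defs
  imports "HOL-Analysis.Analysis"
begin

text \<open>Points of the Cartan group are tuples (x, y, z, v, w).\<close>

type_synonym cartan = "real \<times> real \<times> real \<times> real \<times> real"

fun X1 :: "cartan \<Rightarrow> cartan" where
  "X1 (x, y, z, v, w) = (1, 0, - (y / 2), 0, - ((x\<^sup>2 + y\<^sup>2) / 2))"

fun X2 :: "cartan \<Rightarrow> cartan" where
  "X2 (x, y, z, v, w) = (0, 1, x / 2, (x\<^sup>2 + y\<^sup>2) / 2, 0)"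

definition q0 :: cartan where
  "q0 = (0, 0, 0, 0, 0)"

definition admissible_control :: "real \<Rightarrow> (real \<Rightarrow> real) \<Rightarrow> (real \<Rightarrow> real) \<Rightarrow> bool" where
  "admissible_control T u1 u2 \<longleftrightarrow>
     u1 \<in> borel_measurable (lebesgue_on {0..T}) \<and>
     u2 \<in> borel_measurable (lebesgue_on {0..T}) \<and>
     (\<forall>t\<in>{0..T}. max \<bar>u1 t\<bar> \<bar>u2 t\<bar> \<le> 1)"

text \<open>Caratheodory solutions of \<open>q' = u1 X1(q) + u2 X2(q)\<close>, \<open>q(0) = q0\<close>, on \<open>[0, T]\<close>,
  in integral form. For admissible controls the integrand is bounded and measurable, so the
  integral is the Lebesgue integral.\<close>

definition trajectory ::
    "real \<Rightarrow> (real \<Rightarrow> real) \<Rightarrow> (real \<Rightarrow> real) \<Rightarrow> (real \<Rightarrow> cartan) \<Rightarrow> bool" where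
  "trajectory T u1 u2 q \<longleftrightarrow>
     continuous_on {0..T} q \<and>
     (\<forall>t\<in>{0..T}. ((\<lambda>s. u1 s *\<^sub>R X1 (q s) + u2 s *\<^sub>R X2 (q s)) has_integral (q t - q0)) {0..t})"

definition singular_control :: "real \<Rightarrow> (real \<Rightarrow> real) \<Rightarrow> (real \<Rightarrow> real) \<Rightarrow> bool" where
  "singular_control T u1 u2 \<longleftrightarrow>
     (\<exists>u\<in>{u1, u2}. (\<forall>t\<in>{0..T}. u t = 1) \<or> (\<forall>t\<in>{0..T}. u t = - 1))"

definition attainable_sing :: "real \<Rightarrow> cartan set" where
  "attainable_sing T =
     {q T | q u1 u2. admissible_control T u1 u2 \<and> singular_control T u1 u2 \<and> trajectory T u1 u2 q}"

text \<open>Sign function with values in \<open>{-1, 1}\<close>. Unlike \<^const>\<open>sgn\<close> it must not vanish at 0,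
  since it is used below to select one of two symmetric arguments; either choice at 0 gives
  the same functions.\<close>

definition sg :: "real \<Rightarrow> real" where
  "sg z = (if z < 0 then - 1 else 1)"

definition z_max :: "real \<Rightarrow> real" where
  "z_max x1 = (1 - x1\<^sup>2) / 4"

text \<open>For \<open>x1 = -1\<close> the only relevant value of \<open>z1\<close> is 0, and the quotient
  \<open>z1\<^sup>2 / (1 + x1)\<close> is then 0 by the convention for division by zero, which agrees with
  its limit as \<open>x1\<close> decreases to -1 with \<open>\<bar>z1\<bar> \<le> z_max x1\<close>.\<close>

definition w_max :: "real \<Rightarrow> real \<Rightarrow> real" where
  "w_max x1 z1 =
     1 / 96 * (3 - 15 * x1 - 3 * x1\<^sup>2 - 17 * x1 ^ 3) + z1 / 2 - z1\<^sup>2 / (2 * (1 + x1))"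

definition w_mm :: "real \<Rightarrow> real \<Rightarrow> real" where
  "w_mm x1 z1 =
     1 / 6 * (- x1 * (1 + x1\<^sup>2) + (3 + sg z1) * z1 - 4 * z1\<^sup>2 / (1 + x1))"

text \<open>The maximum of \<open>v\<close> for \<open>u2 = 1\<close> and \<open>z1 \<ge> 0\<close>. The involution \<open>u1 \<mapsto> - u1\<close> maps
  \<open>(x1, z1, w1)\<close> to \<open>(- x1, - z1, - w1)\<close> and preserves \<open>v1\<close>; this expression is not invariant
  under it, so negative \<open>z1\<close> is reduced to positive \<open>z1\<close> in \<open>v_max\<close>, just as in the third
  branch of \<open>v_min\<close>.\<close>

definition v_max_pos :: "real \<Rightarrow> real \<Rightarrow> real \<Rightarrow> real" where
  "v_max_pos x1 z1 w1 =
     1 / 12 * (1 + 3 * x1\<^sup>2 - 6 * (1 - x1) * z1)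
     + sqrt 2 / 48 * sqrt (9 * (1 - x1\<^sup>2 + 4 * z1) ^ 3
         + 8 * (12 * w1 + 3 * x1 + x1 ^ 3 - 6 * (1 - x1) * z1)\<^sup>2)"

definition v_max :: "real \<Rightarrow> real \<Rightarrow> real \<Rightarrow> real" where
  "v_max x1 z1 w1 = v_max_pos (x1 * sg z1) \<bar>z1\<bar> (w1 * sg z1)"

definition v_min_plus :: "real \<Rightarrow> real \<Rightarrow> real \<Rightarrow> real" where
  "v_min_plus x1 z1 w1 =
     1 / 12 * (3 + 12 * w1 + 3 * x1\<^sup>2 + 2 * x1 ^ 3 - 6 * (1 - x1) * z1)
     - 1 / 12 * (1 - x1) * sqrt ((1 - x1) * (1 + 24 * w1 + 3 * x1 + 4 * x1 ^ 3)
         - 12 * (1 - x1) * z1 - 12 * z1\<^sup>2)"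

definition v_min_minus :: "real \<Rightarrow> real \<Rightarrow> real \<Rightarrow> real" where
  "v_min_minus x1 z1 w1 =
     1 / 12 * (1 + 3 * x1\<^sup>2 + 6 * z1 + 6 * x1 * z1
       + sqrt ((1 - 12 * w1 - 2 * x1 - x1\<^sup>2 - 2 * x1 ^ 3 + 2 * (1 + x1) * z1)\<^sup>2
           + 4 * (1 - x1\<^sup>2 - 4 * z1)
               * ((1 + x1) * (6 * w1 + x1 + x1 ^ 3) - 4 * (1 + x1) * z1 + 4 * z1\<^sup>2)))"

definition v_min :: "real \<Rightarrow> real \<Rightarrow> real \<Rightarrow> real" where
  "v_min x1 z1 w1 =
     (if w1 \<ge> w_mm x1 z1 then v_min_plus (- x1) (- z1) (- w1)
      else if w1 \<le> - w_mm (- x1) (- z1) then v_min_plus x1 z1 w1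
      else v_min_minus (x1 * sg z1) \<bar>z1\<bar> (w1 * sg z1))"

end

theory Submission
  imports Defs
begin

text \<open>By dilations and two linear symmetries it suffices to treat \<open>T = 1\<close> and \<open>u2 = 1\<close>. Then \<open>y = t\<close>, the
  first coordinate is an arbitrary \<open>X\<close> with \<open>X 0 = 0\<close> and \<open>\<bar>X'\<bar> \<le> 1\<close>, and \<open>z, w, v\<close> are affine in the
  moments \<open>\<integral>X\<close>, \<open>\<integral>t X\<close>, \<open>\<integral>X\<^sup>2\<close>. For fixed \<open>X 1, z, w\<close> the paths form a convex set, so \<open>v\<close> ranges over an
  interval.

  Lower end: a path consisting of two extremal arcs joined by a straight segment is optimal, since for the
  line \<open>l\<close> through the segment \<open>(X - l) (Y - X) \<ge> 0\<close> for every competitor \<open>Y\<close>.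

  Upper end: in the characteristic coordinates \<open>\<xi> = (t + X) / 2\<close> and \<open>\<beta> = (1 - X 1) / 2 - (t - X) / 2\<close> the
  path bounds a decreasing region of area \<open>N\<close> in a rectangle, and the claim is \<open>4 M M' \<le> N\<^sup>3\<close> for its first
  moments \<open>M, M'\<close> as soon as \<open>N\<close> is at least half of the rectangle. After an affine normalization of \<open>\<beta>\<close> this
  says \<open>E \<bar>F - F'\<bar> \<ge> 2 S / (1 + S)\<close> for independent copies \<open>F, F'\<close> of a centred random variable with values
  in \<open>[- 1, 1]\<close> and variance \<open>S\<close>. This follows by integrating
  \<open>\<bar>x - y\<bar> \<ge> (x - y)\<^sup>2 / (1 - x y) \<ge> (x - y)\<^sup>2 (2 / c - (1 - x y) / c\<^sup>2)\<close> with \<open>c = 1 + S\<close>.\<close>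

section \<open>Indefinite integrals of bounded functions\<close>

text \<open>The bound on \<open>f\<close> holds at every point, which makes \<open>F\<close>
  Lipschitz; the integrals over all initial segments stand in for a pointwise derivative of
  \<open>F\<close>.\<close>

definition indef :: "(real \<Rightarrow> real) \<Rightarrow> (real \<Rightarrow> real) \<Rightarrow> bool" where
  "indef f F \<longleftrightarrow>
     (\<exists>c. \<forall>t\<in>{0..1}. \<bar>f t\<bar> \<le> c) \<and> (\<forall>t\<in>{0..1}. (f has_integral F t) {0..t})"

lemma indefD: "indef f F \<Longrightarrow> 0 \<le> t \<Longrightarrow> t \<le> 1 \<Longrightarrow> (f has_integral F t) {0..t}"
  by (auto simp: indef_def)

lemma indef_bound:
  assumes "indef f F"
  obtains c where "c \<ge> 0" "\<And>t. 0 \<le> t \<Longrightarrow> t \<le> 1 \<Longrightarrow> \<bar>f t\<bar> \<le> c"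
proof -
  obtain c where c: "\<forall>t\<in>{0..1}. \<bar>f t\<bar> \<le> c" using assms by (auto simp: indef_def)
  have "\<bar>f 0\<bar> \<le> c" using c by force
  then have "c \<ge> 0" by linarith
  then show ?thesis using c that[of c] by auto
qed

lemma indef_zero: "indef f F \<Longrightarrow> F 0 = 0"
  using indefD[of f F 0] has_integral_refl(2)[of f 0] by (simp add: has_integral_iff)

lemma indef_interval:
  assumes "indef f F" "0 \<le> s" "s \<le> t" "t \<le> 1"
  shows "(f has_integral (F t - F s)) {s..t}"
proof -
  have "(f has_integral F t) {0..t}" "(f has_integral F s) {0..s}"
    using indefD[OF assms(1)] assms by auto
  moreover have "f integrable_on {s..t}"
    by (rule integrable_on_subinterval[of f "{0..t}"]) (use calculation assms in auto)
  ultimately have "integral {0..s} f + integral {s..t} f = integral {0..t} f"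
    using assms by (intro Henstock_Kurzweil_Integration.integral_combine) auto
  then show ?thesis
    using \<open>f integrable_on {s..t}\<close> \<open>(f has_integral F t) {0..t}\<close> \<open>(f has_integral F s) {0..s}\<close>
    by (simp add: has_integral_iff)
qed

lemma indef_lipschitz:
  assumes "indef f F" "0 \<le> s" "s \<le> t" "t \<le> 1"
    and "c \<ge> 0" "\<And>r. 0 \<le> r \<Longrightarrow> r \<le> 1 \<Longrightarrow> \<bar>f r\<bar> \<le> c"
  shows "\<bar>F t - F s\<bar> \<le> c * (t - s)"
proof -
  have "norm (F t - F s) \<le> c * measure lborel {s..t}"
    by (rule has_integral_bound_real[OF assms(5) finite.emptyI indef_interval[OF assms(1-4)]])
       (use assms in auto)
  then show ?thesis using assms(3) by simp
qed

lemma indef_continuous: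
  assumes "indef f F"
  shows "continuous_on {0..1} F"
proof -
  have "f integrable_on {0..1}" using indefD[OF assms, of 1] by auto
  then have "continuous_on {0..1} (\<lambda>t. integral {0..t} f)"
    by (rule indefinite_integral_continuous_1)
  moreover have "integral {0..t} f = F t" if "t \<in> {0..1}" for t
    using indefD[OF assms, of t] that by auto
  ultimately show ?thesis by (metis (no_types, lifting) continuous_on_cong)
qed

lemma indef_integrable:
  assumes "indef f F"
  shows "f absolutely_integrable_on {0..1}"
proof -
  obtain c where "\<And>t. 0 \<le> t \<Longrightarrow> t \<le> 1 \<Longrightarrow> \<bar>f t\<bar> \<le> c"
    using indef_bound[OF assms] by blast
  then show ?thesis
    using indefD[OF assms, of 1]
    by (intro absolutely_integrable_integrable_bound[of _ f "\<lambda>_. c"]) auto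
qed

lemma indef_from_integrable:
  assumes "f integrable_on {0..1}" "\<And>t. 0 \<le> t \<Longrightarrow> t \<le> 1 \<Longrightarrow> \<bar>f t\<bar> \<le> c"
  shows "indef f (\<lambda>t. integral {0..t} f)"
proof -
  have "f integrable_on {0..t}" if "t \<in> {0..1}" for t
    by (rule integrable_on_subinterval[OF assms(1)]) (use that in auto)
  then show ?thesis unfolding indef_def using assms(2) by (auto intro!: exI[of _ c])
qed

lemma indef_eq:
  assumes "indef f F" "\<And>t. 0 \<le> t \<Longrightarrow> t \<le> 1 \<Longrightarrow> f t = g t"
    and "\<And>t. 0 \<le> t \<Longrightarrow> t \<le> 1 \<Longrightarrow> F t = G t"
  shows "indef g G"
proof -
  have "(g has_integral G t) {0..t}" if "t \<in> {0..1}" for t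
    by (rule has_integral_eq[of _ f]) (use assms that indefD[OF assms(1), of t] in auto)
  moreover obtain c where "\<And>t. 0 \<le> t \<Longrightarrow> t \<le> 1 \<Longrightarrow> \<bar>f t\<bar> \<le> c"
    using indef_bound[OF assms(1)] by blast
  ultimately show ?thesis unfolding indef_def using assms(2) by (metis atLeastAtMost_iff)
qed

lemma indef_add:
  assumes "indef f F" "indef g G"
  shows "indef (\<lambda>t. f t + g t) (\<lambda>t. F t + G t)"
proof -
  obtain c d where "\<And>t. 0 \<le> t \<Longrightarrow> t \<le> 1 \<Longrightarrow> \<bar>f t\<bar> \<le> c" "\<And>t. 0 \<le> t \<Longrightarrow> t \<le> 1 \<Longrightarrow> \<bar>g t\<bar> \<le> d"
    using indef_bound assms by metis
  then have "\<forall>t\<in>{0..1}. \<bar>f t + g t\<bar> \<le> c + d" by (smt (verit) atLeastAtMost_iff)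
  then show ?thesis using assms unfolding indef_def by (auto intro: has_integral_add)
qed

lemma indef_cmult:
  assumes "indef f F"
  shows "indef (\<lambda>t. k * f t) (\<lambda>t. k * F t)"
proof -
  obtain c where "\<And>t. 0 \<le> t \<Longrightarrow> t \<le> 1 \<Longrightarrow> \<bar>f t\<bar> \<le> c" using indef_bound assms by metis
  then have "\<forall>t\<in>{0..1}. \<bar>k * f t\<bar> \<le> \<bar>k\<bar> * c" by (auto simp: abs_mult mult_left_mono)
  then show ?thesis using assms unfolding indef_def by (auto intro: has_integral_mult_right)
qed

lemma indef_mult_continuous:
  assumes f: "indef f F" and g: "continuous_on {0..1} g"
  obtains H where "indef (\<lambda>t. f t * g t) H"
proof -
  have "(\<lambda>t. g t * f t) absolutely_integrable_on {0..1}"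
    using f g
    by (intro absolutely_integrable_bounded_measurable_product_real indef_integrable)
       (auto intro!: continuous_imp_measurable_on_sets_lebesgue
          compact_imp_bounded compact_continuous_image)
  then have "(\<lambda>t. f t * g t) integrable_on {0..1}"
    by (simp add: mult.commute absolutely_integrable_on_def)
  moreover obtain c where c: "c \<ge> 0" "\<And>t. 0 \<le> t \<Longrightarrow> t \<le> 1 \<Longrightarrow> \<bar>f t\<bar> \<le> c"
    using indef_bound f by metis
  moreover have "bounded (g ` {0..1})" using g compact_continuous_image compact_imp_bounded by blast
  then obtain d where d: "\<And>t. 0 \<le> t \<Longrightarrow> t \<le> 1 \<Longrightarrow> \<bar>g t\<bar> \<le> d"
    unfolding bounded_iff by (metis atLeastAtMost_iff image_eqI real_norm_def)
  have "\<bar>f t * g t\<bar> \<le> c * d" if "0 \<le> t" "t \<le> 1" for t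
    using c d[OF that] c(2)[OF that] by (simp add: abs_mult mult_mono)
  ultimately show ?thesis using that indef_from_integrable by blast
qed

lemma indef_const: "indef (\<lambda>t. c) (\<lambda>t. c * t)"
proof -
  have "((\<lambda>t. c) has_integral c * t) {0..t}" if "t \<in> {0..1}" for t
    using has_integral_const_real[of c 0 t] that by (simp add: mult.commute)
  then show ?thesis unfolding indef_def by blast
qed

lemma indef_continuous_fun:
  assumes "continuous_on {0..1} g"
  obtains H where "indef g H"
proof -
  obtain H where "indef (\<lambda>t. 1 * g t) H"
    using indef_mult_continuous[OF indef_const[of 1] assms] by blast
  then show ?thesis using that by simp
qed

text \<open>Increments of quadratic order force a zero derivative at every point of the interval, so
  \<open>E\<close> is constant.\<close>

lemma zero_of_square_bound:
  fixes E :: "real \<Rightarrow> real"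
  assumes E0: "E 0 = 0"
    and bd: "\<And>s t. 0 \<le> s \<Longrightarrow> s \<le> t \<Longrightarrow> t \<le> 1 \<Longrightarrow> \<bar>E t - E s\<bar> \<le> c * (t - s)\<^sup>2"
    and t: "0 \<le> t" "t \<le> 1"
  shows "E t = 0"
proof -
  have bd': "\<bar>E y - E x\<bar> \<le> \<bar>c\<bar> * (y - x)\<^sup>2" if "x \<in> {0..1}" "y \<in> {0..1}" for x y
  proof (cases "x \<le> y")
    case True
    then have "\<bar>E y - E x\<bar> \<le> c * (y - x)\<^sup>2" using bd that by auto
    also have "\<dots> \<le> \<bar>c\<bar> * (y - x)\<^sup>2" by (intro mult_right_mono) auto
    finally show ?thesis .
  next
    case False
    then have "\<bar>E x - E y\<bar> \<le> c * (x - y)\<^sup>2" using bd that by auto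
    also have "\<dots> \<le> \<bar>c\<bar> * (x - y)\<^sup>2" by (intro mult_right_mono) auto
    finally show ?thesis by (simp add: abs_minus_commute power2_commute)
  qed
  have "(E has_field_derivative 0) (at x within {0..1})" if "x \<in> {0..1}" for x
  proof -
    have "((\<lambda>y. \<bar>c\<bar> * \<bar>y - x\<bar>) \<longlongrightarrow> \<bar>c\<bar> * \<bar>x - x\<bar>) (at x within {0..1})"
      by (intro tendsto_intros)
    then have lim: "((\<lambda>y. \<bar>c\<bar> * \<bar>y - x\<bar>) \<longlongrightarrow> 0) (at x within {0..1})" by simp
    have "((\<lambda>y. (E y - E x) / (y - x)) \<longlongrightarrow> 0) (at x within {0..1})"
    proof (rule Lim_null_comparison[OF _ lim], unfold eventually_at, intro exI conjI ballI impI)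
      show "(1::real) > 0" by simp
      fix y assume y: "y \<in> {0..1}" "y \<noteq> x \<and> dist y x < 1"
      have "\<bar>E y - E x\<bar> \<le> \<bar>c\<bar> * \<bar>y - x\<bar> * \<bar>y - x\<bar>"
        using bd'[OF that y(1)] by (simp add: power2_eq_square mult.assoc)
      then show "norm ((E y - E x) / (y - x)) \<le> \<bar>c\<bar> * \<bar>y - x\<bar>"
        using y by (simp add: field_simps)
    qed
    then show ?thesis by (simp add: has_field_derivative_iff)
  qed
  then obtain k where "\<And>x. x \<in> {0..1} \<Longrightarrow> E x = k"
    using has_field_derivative_zero_constant[of "{0..1}" E] by auto
  then show ?thesis using E0 t by (metis atLeastAtMost_iff order.refl order_trans)
qed

text \<open>The product rule in integral form, valid although \<open>F\<close> and \<open>G\<close>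
  may fail to be differentiable at some points. The product and the integral \<open>H1 + H2\<close>
  of the expected derivative differ by a function whose increments are of quadratic order, so
  \<open>zero_of_square_bound\<close> applies.\<close>

lemma indef_mult:
  assumes f: "indef f F" and g: "indef g G"
  shows "indef (\<lambda>t. f t * G t + F t * g t) (\<lambda>t. F t * G t)"
proof -
  obtain H1 where H1: "indef (\<lambda>t. f t * G t) H1"
    using indef_mult_continuous[OF f indef_continuous[OF g]] .
  obtain H2 where H2: "indef (\<lambda>t. g t * F t) H2"
    using indef_mult_continuous[OF g indef_continuous[OF f]] .
  have H: "indef (\<lambda>t. f t * G t + F t * g t) (\<lambda>t. H1 t + H2 t)"
    using indef_add[OF H1 H2] by (simp add: mult.commute)
  obtain c where c: "c \<ge> 0" "\<And>t. 0 \<le> t \<Longrightarrow> t \<le> 1 \<Longrightarrow> \<bar>f t\<bar> \<le> c" using indef_bound[OF f] by blast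
  obtain d where d: "d \<ge> 0" "\<And>t. 0 \<le> t \<Longrightarrow> t \<le> 1 \<Longrightarrow> \<bar>g t\<bar> \<le> d" using indef_bound[OF g] by blast
  let ?E = "\<lambda>t. F t * G t - (H1 t + H2 t)"
  have "\<bar>?E t - ?E s\<bar> \<le> (3 * c * d) * (t - s)\<^sup>2" if st: "0 \<le> s" "s \<le> t" "t \<le> 1" for s t
  proof -
    \<comment> \<open>Subtracting the values of \<open>F\<close> and \<open>G\<close> frozen at
      \<open>s\<close> leaves an integrand of size at most \<open>2 * c * d * (t - s)\<close>. The
      mixed increment \<open>(F t - F s) * (G t - G s)\<close> contributes the third
      \<open>c * d\<close>.\<close>
    have i: "((\<lambda>r. f r * (G r - G s) + (F r - F s) * g r) has_integral
        ((H1 t + H2 t) - (H1 s + H2 s)) - (G s * (F t - F s) + F s * (G t - G s))) {s..t}"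
    proof (rule has_integral_eq[rotated])
      show "((\<lambda>r. (f r * G r + F r * g r) - (G s * f r + F s * g r)) has_integral
        ((H1 t + H2 t) - (H1 s + H2 s)) - (G s * (F t - F s) + F s * (G t - G s))) {s..t}"
        by (intro has_integral_diff has_integral_add has_integral_mult_right
            indef_interval[OF f st] indef_interval[OF g st] indef_interval[OF H st])
    qed (simp add: algebra_simps)
    have "\<bar>f r * (G r - G s) + (F r - F s) * g r\<bar> \<le> 2 * c * d * (t - s)" if "r \<in> {s..t}" for r
    proof -
      have "\<bar>G r - G s\<bar> \<le> d * (r - s)" "\<bar>F r - F s\<bar> \<le> c * (r - s)"
        using indef_lipschitz[OF f, of s r c] indef_lipschitz[OF g, of s r d] c d that st by auto
      then have "\<bar>G r - G s\<bar> \<le> d * (t - s)" "\<bar>F r - F s\<bar> \<le> c * (t - s)"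
        using that mult_left_mono[of "r - s" "t - s"] c(1) d(1)
        by (smt (verit) atLeastAtMost_iff)+
      then have "\<bar>f r * (G r - G s)\<bar> \<le> c * (d * (t - s))" "\<bar>(F r - F s) * g r\<bar> \<le> (c * (t - s)) * d"
        unfolding abs_mult using c d that st by (intro mult_mono; auto)+
      then show ?thesis by (simp add: algebra_simps)
    qed
    then have "\<bar>((H1 t + H2 t) - (H1 s + H2 s)) - (G s * (F t - F s) + F s * (G t - G s))\<bar>
        \<le> 2 * c * d * (t - s) * (t - s)"
      using has_integral_bound_real[OF _ finite.emptyI i, of "2 * c * d * (t - s)"] c(1) d(1) st by auto
    moreover have "\<bar>(F t - F s) * (G t - G s)\<bar> \<le> (c * (t - s)) * (d * (t - s))"
      unfolding abs_mult using indef_lipschitz[OF f st c] indef_lipschitz[OF g st d] c(1) st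
      by (intro mult_mono) auto
    moreover have "?E t - ?E s = (F t - F s) * (G t - G s) -
      (((H1 t + H2 t) - (H1 s + H2 s)) - (G s * (F t - F s) + F s * (G t - G s)))"
      by (simp add: algebra_simps)
    ultimately show ?thesis by (simp add: power2_eq_square algebra_simps)
  qed
  then have "?E t = 0" if "0 \<le> t" "t \<le> 1" for t
    using zero_of_square_bound[of ?E "3 * c * d" t] that indef_zero[OF f] indef_zero[OF H] by simp
  then show ?thesis by (intro indef_eq[OF H]) auto
qed

section \<open>Paths and their moments\<close>

definition steer :: "(real \<Rightarrow> real) \<Rightarrow> (real \<Rightarrow> real) \<Rightarrow> bool" where
  "steer u X \<longleftrightarrow> indef u X \<and> (\<forall>t\<in>{0..1}. \<bar>u t\<bar> \<le> 1)"

definition moments :: "(real \<Rightarrow> real) \<Rightarrow> real \<Rightarrow> real \<Rightarrow> real \<Rightarrow> bool" where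
  "moments X A B C \<longleftrightarrow>
     (X has_integral A) {0..1} \<and> ((\<lambda>t. t * X t) has_integral B) {0..1} \<and>
     ((\<lambda>t. (X t)\<^sup>2) has_integral C) {0..1}"

text \<open>The point \<open>(a, 1, z, v, w)\<close> is attained at time 1 with \<open>u2 = 1\<close>; the integrals defining \<open>z, v, w\<close> have
  been solved for the moments of the first coordinate.\<close>

definition reach :: "real \<Rightarrow> real \<Rightarrow> real \<Rightarrow> real \<Rightarrow> bool" where
  "reach a z w v \<longleftrightarrow>
     (\<exists>u X. steer u X \<and> X 1 = a \<and> moments X (z + a / 2) (w + a ^ 3 / 6 + a / 2) (2 * v - 1 / 3))"

lemma steer_indef: "steer u X \<Longrightarrow> indef u X"
  by (simp add: steer_def)

lemma steer_increment:
  assumes "steer u X" "0 \<le> s" "s \<le> t" "t \<le> 1"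
  shows "\<bar>X t - X s\<bar> \<le> t - s"
  using indef_lipschitz[OF steer_indef[OF assms(1)] assms(2-4), of 1] assms(1)
  by (auto simp: steer_def)

lemma indef_id: "indef (\<lambda>t. 1) (\<lambda>t. t)"
  using indef_const[of 1] by simp

text \<open>Integration by parts, applied to t X, \<open>t\<^sup>2 * X\<close>,
  \<open>X\<^sup>2\<close>, \<open>t * X\<^sup>2\<close> and \<open>X ^ 3\<close>. All of these
  vanish at 0, so only \<open>X 1\<close> and the three moments of \<open>X\<close> survive.\<close>

lemma control_moments:
  assumes "steer u X" "moments X A B C"
  shows "(u has_integral X 1) {0..1}"
    and "((\<lambda>t. u t * t) has_integral (X 1 - A)) {0..1}"
    and "((\<lambda>t. u t * t\<^sup>2) has_integral (X 1 - 2 * B)) {0..1}"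
    and "((\<lambda>t. u t * X t) has_integral ((X 1)\<^sup>2 / 2)) {0..1}"
    and "((\<lambda>t. u t * (t * X t)) has_integral ((X 1)\<^sup>2 / 2 - C / 2)) {0..1}"
    and "((\<lambda>t. u t * (X t)\<^sup>2) has_integral ((X 1) ^ 3 / 3)) {0..1}"
proof -
  have u: "indef u X" using assms(1) by (rule steer_indef)
  have A: "(X has_integral A) {0..1}" and B: "((\<lambda>t. t * X t) has_integral B) {0..1}"
    and C: "((\<lambda>t. (X t)\<^sup>2) has_integral C) {0..1}" using assms(2) by (auto simp: moments_def)
  show "(u has_integral X 1) {0..1}" using indefD[OF u, of 1] by simp
  note tX = indef_mult[OF indef_id u]
  have 1: "((\<lambda>t. 1 * X t + t * u t) has_integral X 1) {0..1}" using indefD[OF tX, of 1] by simp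
  show "((\<lambda>t. u t * t) has_integral (X 1 - A)) {0..1}"
    using has_integral_diff[OF 1 A] by (simp add: mult.commute)
  have 2: "((\<lambda>t. 1 * (t * X t) + t * (1 * X t + t * u t)) has_integral X 1) {0..1}"
    using indefD[OF indef_mult[OF indef_id tX], of 1] by simp
  show "((\<lambda>t. u t * t\<^sup>2) has_integral (X 1 - 2 * B)) {0..1}"
    by (rule has_integral_eq[OF _ has_integral_diff[OF 2 has_integral_mult_right[OF B, of 2]]])
       (simp add: algebra_simps power2_eq_square)
  note XX = indef_mult[OF u u]
  have 3: "((\<lambda>t. u t * X t + X t * u t) has_integral (X 1 * X 1)) {0..1}"
    using indefD[OF XX, of 1] by simp
  show "((\<lambda>t. u t * X t) has_integral ((X 1)\<^sup>2 / 2)) {0..1}"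
    using has_integral_mult_right[OF 3, of "1 / 2"]
    by (simp add: algebra_simps power2_eq_square)
  have 4: "((\<lambda>t. 1 * (X t * X t) + t * (u t * X t + X t * u t)) has_integral (X 1 * X 1)) {0..1}"
    using indefD[OF indef_mult[OF indef_id XX], of 1] by simp
  show "((\<lambda>t. u t * (t * X t)) has_integral ((X 1)\<^sup>2 / 2 - C / 2)) {0..1}"
    using has_integral_mult_right[OF has_integral_diff[OF 4 C], of "1 / 2"]
    by (simp add: algebra_simps power2_eq_square)
  have 5: "((\<lambda>t. u t * (X t * X t) + X t * (u t * X t + X t * u t)) has_integral (X 1 * (X 1 * X 1))) {0..1}"
    using indefD[OF indef_mult[OF u XX], of 1] by simp
  show "((\<lambda>t. u t * (X t)\<^sup>2) has_integral ((X 1) ^ 3 / 3)) {0..1}"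
    using has_integral_mult_right[OF 5, of "1 / 3"]
    by (simp add: algebra_simps power2_eq_square power3_eq_cube)
qed

text \<open>A template: the twelve coefficients describe an arbitrary quadratic polynomial in t and
  X plus another one multiplied by the control. Later integrals are read off by choosing
  coefficients.\<close>

lemma has_integral_quadratic:
  assumes "steer u X" "moments X A B C"
  shows "((\<lambda>t. (k0 + k1 * t + k2 * t\<^sup>2 + k3 * X t + k4 * (t * X t) + k5 * (X t)\<^sup>2)
      + (l0 * u t + l1 * (u t * t) + l2 * (u t * t\<^sup>2) + l3 * (u t * X t) + l4 * (u t * (t * X t))
         + l5 * (u t * (X t)\<^sup>2))) has_integral
     ((k0 * 1 + k1 * (1 / 2) + k2 * (1 / 3) + k3 * A + k4 * B + k5 * C)
      + (l0 * X 1 + l1 * (X 1 - A) + l2 * (X 1 - 2 * B) + l3 * ((X 1)\<^sup>2 / 2)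
         + l4 * ((X 1)\<^sup>2 / 2 - C / 2) + l5 * (X 1 ^ 3 / 3)))) {0..1}"
proof -
  note m = control_moments[OF assms]
  have "(X has_integral A) {0..1}" and "((\<lambda>t. t * X t) has_integral B) {0..1}"
    and "((\<lambda>t. (X t)\<^sup>2) has_integral C) {0..1}" using assms(2) by (auto simp: moments_def)
  moreover have "((\<lambda>t::real. k0) has_integral k0 * 1) {0..1}"
    using indefD[OF indef_const[of k0], of 1] by simp
  moreover have "((\<lambda>t. t) has_integral (1 / 2 :: real)) {0..1}"
    using ident_has_integral[of 0 "1::real"] by simp
  moreover have "((\<lambda>t::real. t\<^sup>2) has_integral 1 / 3) {0..1}"
    using has_integral_mult_right[OF indefD[OF indef_mult[OF indef_id indef_mult[OF indef_id indef_id]],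
      of 1], of "1 / 3"] by (simp add: power2_eq_square)
  ultimately show ?thesis
    by (intro has_integral_add has_integral_mult_right m) auto
qed

text \<open>With \<open>M\<close> and \<open>M'\<close> the first moments (in \<open>\<xi>\<close> and in \<open>\<beta>\<close>) of the region described at the beginning,
  \<open>area\<close> is its area, \<open>skew = M - M'\<close> and \<open>v = base + 2 (M + M')\<close>.\<close>

definition area :: "real \<Rightarrow> real \<Rightarrow> real" where
  "area a z = (1 - a\<^sup>2 + 4 * z) / 8"

definition skew :: "real \<Rightarrow> real \<Rightarrow> real \<Rightarrow> real" where
  "skew a z w = (12 * w + 3 * a + a ^ 3 - 6 * (1 - a) * z) / 24"

definition base :: "real \<Rightarrow> real \<Rightarrow> real" where
  "base a z = (1 + 3 * a\<^sup>2 - 6 * (1 - a) * z) / 12"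

text \<open>Since \<open>\<rho>\<close> is the density of \<open>\<xi>\<close>, integrating against
  \<open>\<rho>\<close> means integrating in \<open>\<xi>\<close>. For the region below the graph of
  \<open>\<beta>\<close> over \<open>\<xi>\<close>, the five values are its width, half the squared
  width, its area N, the moment M, and twice the moment M'.\<close>

lemma rotated_moments:
  assumes X: "steer u X" "X 1 = a"
    and m: "moments X (z + a / 2) (w + a ^ 3 / 6 + a / 2) (2 * v - 1 / 3)"
  defines "\<rho> \<equiv> \<lambda>t. (1 + u t) / 2" and "\<xi> \<equiv> \<lambda>t. (t + X t) / 2"
    and "\<beta> \<equiv> \<lambda>t. (1 - a) / 2 - (t - X t) / 2"
  shows "(\<rho> has_integral (1 + a) / 2) {0..1}"
    and "((\<lambda>t. \<xi> t * \<rho> t) has_integral ((1 + a) / 2)\<^sup>2 / 2) {0..1}"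
    and "((\<lambda>t. \<beta> t * \<rho> t) has_integral area a z) {0..1}"
    and "((\<lambda>t. \<xi> t * \<beta> t * \<rho> t) has_integral ((v - base a z) / 2 + skew a z w) / 2) {0..1}"
    and "((\<lambda>t. (\<beta> t)\<^sup>2 * \<rho> t) has_integral ((v - base a z) / 2 - skew a z w)) {0..1}"
proof -
  have eq: "(f has_integral i) {0..1} \<Longrightarrow> (\<And>t. f t = g t) \<Longrightarrow> i = j \<Longrightarrow> (g has_integral j) {0..1}"
    for f g :: "real \<Rightarrow> real" and i j
    by (metis ext)
  note q = has_integral_quadratic[OF X(1) m, unfolded X(2)]
  note d = \<rho>_def \<xi>_def \<beta>_def area_def skew_def base_def
  note a = algebra_simps power2_eq_square power3_eq_cube add_divide_distrib diff_divide_distrib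
  show "(\<rho> has_integral (1 + a) / 2) {0..1}"
    by (rule eq[OF q[of "1/2" 0 0 0 0 0 "1/2" 0 0 0 0 0]]) (simp_all add: d a)
  show "((\<lambda>t. \<xi> t * \<rho> t) has_integral ((1 + a) / 2)\<^sup>2 / 2) {0..1}"
    by (rule eq[OF q[of 0 "1/4" 0 "1/4" 0 0 0 "1/4" 0 "1/4" 0 0]]) (simp_all add: d a)
  show "((\<lambda>t. \<beta> t * \<rho> t) has_integral area a z) {0..1}"
    by (rule eq[OF q[of "(1-a)/4" "-1/4" 0 "1/4" 0 0 "(1-a)/4" "-1/4" 0 "1/4" 0 0]])
       (simp_all add: d a)
  show "((\<lambda>t. \<xi> t * \<beta> t * \<rho> t) has_integral ((v - base a z) / 2 + skew a z w) / 2) {0..1}"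
    by (rule eq[OF q[of 0 "(1-a)/8" "-1/8" "(1-a)/8" 0 "1/8" 0 "(1-a)/8" "-1/8" "(1-a)/8" 0 "1/8"]])
       (simp_all add: d a)
  show "((\<lambda>t. (\<beta> t)\<^sup>2 * \<rho> t) has_integral ((v - base a z) / 2 - skew a z w)) {0..1}"
    by (rule eq[OF q[of "(1-a)\<^sup>2/8" "-(1-a)/4" "1/8" "(1-a)/4" "-1/4" "1/8"
                        "(1-a)\<^sup>2/8" "-(1-a)/4" "1/8" "(1-a)/4" "-1/4" "1/8"]])
       (simp_all add: d a)
qed

section \<open>The upper bounds\<close>

text \<open>The reciprocal is convex, so \<open>1 / d\<close> lies above its tangent
  \<open>2 / c - d / c\<^sup>2\<close> at \<open>c\<close>, and
  \<open>\<bar>x - y\<bar> \<le> 1 - x * y\<close> on the square. The result is a polynomial lower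
  bound, which can be integrated in both variables using moments only.\<close>

lemma abs_diff_ge_quartic:
  fixes x y c :: real
  assumes "\<bar>x\<bar> \<le> 1" "\<bar>y\<bar> \<le> 1" "c > 0"
  shows "(x - y)\<^sup>2 * (2 / c - (1 - x * y) / c\<^sup>2) \<le> \<bar>x - y\<bar>"
proof -
  define d where "d = \<bar>x - y\<bar>"
  have "0 \<le> (1 - x) * (1 + y)" "0 \<le> (1 + x) * (1 - y)" using assms by auto
  then have d: "0 \<le> d" "d \<le> 1 - x * y" by (auto simp: d_def algebra_simps abs_if)
  have "d\<^sup>2 * (2 / c - (1 - x * y) / c\<^sup>2) \<le> d\<^sup>2 * (2 / c - d / c\<^sup>2)"
    using d by (intro mult_left_mono diff_left_mono divide_right_mono) auto
  also have "\<dots> \<le> d"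
  proof -
    have "0 \<le> d * (d - c)\<^sup>2" using d by simp
    then show ?thesis using assms(3)
      by (simp add: field_simps power2_eq_square power3_eq_cube)
  qed
  finally show ?thesis by (simp add: d_def)
qed

text \<open>With \<open>\<rho> / P\<close> as probability density, \<open>f\<close> is a centred
  variable of variance \<open>S\<close>. As \<open>f\<close> is nonincreasing, the double integral
  of \<open>\<bar>f t - f s\<bar>\<close> against both densities equals \<open>- 4 * E\<close>, so
  this is the estimate of the mean difference by 2 S / (1 + S). The double integral is taken as two
  successive one-dimensional ones.\<close>

lemma gini_mean_difference_bound:
  assumes \<rho>: "indef \<rho> \<xi>" and \<rho>0: "\<And>t. 0 \<le> t \<Longrightarrow> t \<le> 1 \<Longrightarrow> \<rho> t \<ge> 0"
    and f: "continuous_on {0..1} f" "\<And>s t. 0 \<le> s \<Longrightarrow> s \<le> t \<Longrightarrow> t \<le> 1 \<Longrightarrow> f t \<le> f s"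
      "\<And>t. 0 \<le> t \<Longrightarrow> t \<le> 1 \<Longrightarrow> \<bar>f t\<bar> \<le> 1"
    and P: "\<xi> 1 = P" "P > 0"
    and m1: "((\<lambda>t. f t * \<rho> t) has_integral 0) {0..1}"
    and m2: "((\<lambda>t. (f t)\<^sup>2 * \<rho> t) has_integral S * P) {0..1}"
    and E: "((\<lambda>t. \<xi> t * f t * \<rho> t) has_integral E) {0..1}"
  shows "S * P\<^sup>2 \<le> - 2 * E * (1 + S)"
proof -
  have "S * P \<ge> 0" by (rule has_integral_nonneg[OF m2]) (use \<rho>0 in auto)
  then have S: "S \<ge> 0" using P by (simp add: zero_le_mult_iff)
  obtain J where J: "indef (\<lambda>t. \<rho> t * f t) J"
    using indef_mult_continuous[OF \<rho> f(1)] by blast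
  have J1: "J 1 = 0" using indefD[OF J, of 1] m1 has_integral_unique
    by (simp add: mult.commute) blast
  \<comment> \<open>The third moment of \<open>f\<close> is left unknown: in the outer integration
    it is multiplied by the mean of \<open>f\<close>, which is 0.\<close>
  obtain J3 where J3: "indef (\<lambda>t. \<rho> t * f t ^ 3) J3"
    using indef_mult_continuous[OF \<rho>, of "\<lambda>t. f t ^ 3"] f(1) by (auto intro: continuous_on_power)
  define m3 where "m3 = J3 1"
  have m3: "((\<lambda>t. f t ^ 3 * \<rho> t) has_integral m3) {0..1}"
    using indefD[OF J3, of 1] by (simp add: m3_def mult.commute)
  have m0: "(\<rho> has_integral P) {0..1}" using indefD[OF \<rho>, of 1] P by simp
  \<comment> \<open>The integrated lower bound is
    \<open>4 * S / c - 2 * S * (1 + S) / c\<^sup>2\<close> in normalized form; this \<open>c\<close>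
    maximizes it, with value 2 S / (1 + S).\<close>
  define c where "c = 1 + S"
  have c: "c > 0" using S by (simp add: c_def)
  define A where "A = 2 / c - 1 / c\<^sup>2"
  define B where "B = 1 / c\<^sup>2"
  have pw: "A * x\<^sup>2 - 2 * A * x * y + A * y\<^sup>2 + B * x ^ 3 * y - 2 * B * x\<^sup>2 * y\<^sup>2 + B * x * y ^ 3 \<le> \<bar>x - y\<bar>"
    if "\<bar>x\<bar> \<le> 1" "\<bar>y\<bar> \<le> 1" for x y
    using abs_diff_ge_quartic[OF that c]
    by (simp add: A_def B_def algebra_simps power2_eq_square power3_eq_cube add_divide_distrib diff_divide_distrib)
  \<comment> \<open>The inequality \<open>pw\<close> at x = f t, y = f s, integrated in
    \<open>s\<close>. Monotonicity of \<open>f\<close> fixes the sign of f t - f s on either side of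
    \<open>t\<close>, so the right-hand side is expressed by \<open>J\<close> and
    \<open>\<xi>\<close>.\<close>
  have inner: "P * A * (f t)\<^sup>2 + A * S * P - 2 * B * S * P * (f t)\<^sup>2 + B * m3 * f t
      \<le> 2 * J t - 2 * f t * \<xi> t + P * f t" if t: "0 \<le> t" "t \<le> 1" for t
  proof -
    let ?x = "f t"
    have "((\<lambda>s. \<bar>?x - f s\<bar> * \<rho> s) has_integral (J t - ?x * \<xi> t)) {0..t}"
      by (rule has_integral_eq[OF _ has_integral_diff[OF indefD[OF J t]
              has_integral_mult_right[OF indefD[OF \<rho> t], of ?x]]])
        (use t f(2) in \<open>auto simp: algebra_simps\<close>)
    moreover have "((\<lambda>s. \<bar>?x - f s\<bar> * \<rho> s) has_integral (?x * (\<xi> 1 - \<xi> t) - (J 1 - J t))) {t..1}"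
      by (rule has_integral_eq[OF _ has_integral_diff[OF
              has_integral_mult_right[OF indef_interval[OF \<rho> t(1,2)], of ?x] indef_interval[OF J t(1,2)]]])
        (use t f(2) in \<open>auto simp: algebra_simps\<close>)
    ultimately have L: "((\<lambda>s. \<bar>?x - f s\<bar> * \<rho> s) has_integral
        (J t - ?x * \<xi> t + (?x * (\<xi> 1 - \<xi> t) - (J 1 - J t)))) {0..1}"
      using t by (intro has_integral_combine[of 0 t 1]) auto
    have Q: "((\<lambda>s. A * ?x\<^sup>2 * \<rho> s - 2 * A * ?x * (f s * \<rho> s) + A * ((f s)\<^sup>2 * \<rho> s)
          + B * ?x ^ 3 * (f s * \<rho> s) - 2 * B * ?x\<^sup>2 * ((f s)\<^sup>2 * \<rho> s) + B * ?x * (f s ^ 3 * \<rho> s))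
        has_integral (A * ?x\<^sup>2 * P - 2 * A * ?x * 0 + A * (S * P)
          + B * ?x ^ 3 * 0 - 2 * B * ?x\<^sup>2 * (S * P) + B * ?x * m3)) {0..1}"
      by (intro has_integral_add has_integral_diff has_integral_mult_right m0 m1 m2 m3)
    have "A * ?x\<^sup>2 * P - 2 * A * ?x * 0 + A * (S * P)
          + B * ?x ^ 3 * 0 - 2 * B * ?x\<^sup>2 * (S * P) + B * ?x * m3
        \<le> J t - ?x * \<xi> t + (?x * (\<xi> 1 - \<xi> t) - (J 1 - J t))"
    proof (rule has_integral_le[OF Q L])
      fix s :: real assume s: "s \<in> {0..1}"
      have "(A * ?x\<^sup>2 - 2 * A * ?x * f s + A * (f s)\<^sup>2 + B * ?x ^ 3 * f s - 2 * B * ?x\<^sup>2 * (f s)\<^sup>2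
          + B * ?x * f s ^ 3) * \<rho> s \<le> \<bar>?x - f s\<bar> * \<rho> s"
        using s t by (intro mult_right_mono pw f(3) \<rho>0) auto
      then show "A * ?x\<^sup>2 * \<rho> s - 2 * A * ?x * (f s * \<rho> s) + A * ((f s)\<^sup>2 * \<rho> s)
          + B * ?x ^ 3 * (f s * \<rho> s) - 2 * B * ?x\<^sup>2 * ((f s)\<^sup>2 * \<rho> s) + B * ?x * (f s ^ 3 * \<rho> s)
          \<le> \<bar>?x - f s\<bar> * \<rho> s"
        by (simp add: algebra_simps)
    qed
    then show ?thesis by (simp add: P J1 algebra_simps)
  qed
  \<comment> \<open>Integration by parts; the boundary term vanishes because
    \<open>J 1 = 0\<close>.\<close>
  have Jr: "((\<lambda>t. J t * \<rho> t) has_integral - E) {0..1}"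
  proof -
    have "((\<lambda>t. (\<rho> t * f t) * \<xi> t + J t * \<rho> t) has_integral J 1 * \<xi> 1) {0..1}"
      using indefD[OF indef_mult[OF J \<rho>], of 1] by simp
    from has_integral_diff[OF this E] show ?thesis by (simp add: J1 algebra_simps)
  qed
  have "((\<lambda>t. P * A * ((f t)\<^sup>2 * \<rho> t) + A * S * P * \<rho> t - 2 * B * S * P * ((f t)\<^sup>2 * \<rho> t) + B * m3 * (f t * \<rho> t))
     has_integral (P * A * (S * P) + A * S * P * P - 2 * B * S * P * (S * P) + B * m3 * 0)) {0..1}"
    by (intro has_integral_add has_integral_diff has_integral_mult_right m0 m1 m2)
  moreover have "((\<lambda>t. 2 * (J t * \<rho> t) - 2 * (\<xi> t * f t * \<rho> t) + P * (f t * \<rho> t))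
     has_integral (2 * (- E) - 2 * E + P * 0)) {0..1}"
    by (intro has_integral_add has_integral_diff has_integral_mult_right Jr E m1)
  ultimately have "P * A * (S * P) + A * S * P * P - 2 * B * S * P * (S * P) + B * m3 * 0
      \<le> 2 * (- E) - 2 * E + P * 0"
  proof (rule has_integral_le)
    fix t :: real assume t: "t \<in> {0..1}"
    have "(P * A * (f t)\<^sup>2 + A * S * P - 2 * B * S * P * (f t)\<^sup>2 + B * m3 * f t) * \<rho> t
      \<le> (2 * J t - 2 * f t * \<xi> t + P * f t) * \<rho> t"
      using t by (intro mult_right_mono inner \<rho>0) auto
    then show "P * A * ((f t)\<^sup>2 * \<rho> t) + A * S * P * \<rho> t - 2 * B * S * P * ((f t)\<^sup>2 * \<rho> t) + B * m3 * (f t * \<rho> t)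
      \<le> 2 * (J t * \<rho> t) - 2 * (\<xi> t * f t * \<rho> t) + P * (f t * \<rho> t)"
      by (simp add: algebra_simps)
  qed
  then have "2 * S * P\<^sup>2 * (A - B * S) \<le> - 4 * E" by (simp add: power2_eq_square algebra_simps)
  moreover have "A - B * S = 1 / c"
    using c by (simp add: A_def B_def field_simps power2_eq_square) (simp add: c_def algebra_simps)
  ultimately have "2 * S * P\<^sup>2 \<le> - 4 * E * c" using c by (simp add: field_simps)
  then show "S * P\<^sup>2 \<le> - 2 * E * (1 + S)" by (simp add: c_def)
qed

section \<open>Geometry of the region bounded by a path, and the bounds on z, w and v\<close>

lemma steer_zero: "steer u X \<Longrightarrow> X 0 = 0"
  by (rule indef_zero[OF steer_indef])

lemma reach_abs_le: "reach a z w v \<Longrightarrow> \<bar>a\<bar> \<le> 1"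
  using steer_increment[of _ _ 0 1] steer_zero by (fastforce simp: reach_def)

lemma reach_reflect:
  assumes "reach a z w v"
  shows "reach (- a) (- z) (- w) v"
proof -
  obtain u X where u: "steer u X" "X 1 = a"
    and m: "moments X (z + a / 2) (w + a ^ 3 / 6 + a / 2) (2 * v - 1 / 3)"
    using assms by (auto simp: reach_def)
  have "steer (\<lambda>t. - u t) (\<lambda>t. - X t)"
    using u(1) indef_cmult[of u X "-1"] by (auto simp: steer_def)
  moreover have "moments (\<lambda>t. - X t) (- (z + a / 2)) (- (w + a ^ 3 / 6 + a / 2)) (2 * v - 1 / 3)"
    using m by (auto simp: moments_def dest: has_integral_neg)
  ultimately show ?thesis unfolding reach_def using u(2)
    by (intro exI[of _ "\<lambda>t. - u t"] exI[of _ "\<lambda>t. - X t"]) (simp add: algebra_simps)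
qed

text \<open>Collects what the upper bounds use of a path in characteristic coordinates:
  \<open>\<xi>\<close> increases from 0 to the width of the rectangle, while \<open>\<beta>\<close>
  decreases within its height.\<close>

lemma reach_profile:
  assumes "reach a z w v"
  obtains \<rho> \<xi> \<beta> :: "real \<Rightarrow> real" where
    "indef \<rho> \<xi>" "\<And>t. 0 \<le> t \<Longrightarrow> t \<le> 1 \<Longrightarrow> \<rho> t \<ge> 0"
    "continuous_on {0..1} \<xi>" "continuous_on {0..1} \<beta>"
    "\<And>s t. 0 \<le> s \<Longrightarrow> s \<le> t \<Longrightarrow> t \<le> 1 \<Longrightarrow> \<xi> s \<le> \<xi> t"
    "\<And>s t. 0 \<le> s \<Longrightarrow> s \<le> t \<Longrightarrow> t \<le> 1 \<Longrightarrow> \<beta> t \<le> \<beta> s"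
    "\<And>t. 0 \<le> t \<Longrightarrow> t \<le> 1 \<Longrightarrow> \<xi> t \<in> {0..1}"
    "\<And>t. 0 \<le> t \<Longrightarrow> t \<le> 1 \<Longrightarrow> \<beta> t \<in> {0..(1 - a) / 2}"
    "\<xi> 0 = 0" "\<xi> 1 = (1 + a) / 2"
    "(\<rho> has_integral (1 + a) / 2) {0..1}"
    "((\<lambda>t. \<xi> t * \<rho> t) has_integral ((1 + a) / 2)\<^sup>2 / 2) {0..1}"
    "((\<lambda>t. \<beta> t * \<rho> t) has_integral area a z) {0..1}"
    "((\<lambda>t. \<xi> t * \<beta> t * \<rho> t) has_integral ((v - base a z) / 2 + skew a z w) / 2) {0..1}"
    "((\<lambda>t. (\<beta> t)\<^sup>2 * \<rho> t) has_integral ((v - base a z) / 2 - skew a z w)) {0..1}"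
proof -
  obtain u X where u: "steer u X" "X 1 = a"
    and m: "moments X (z + a / 2) (w + a ^ 3 / 6 + a / 2) (2 * v - 1 / 3)"
    using assms by (auto simp: reach_def)
  note X0 = steer_zero[OF u(1)]
  note inc = steer_increment[OF u(1)]
  have X: "continuous_on {0..1} X" by (rule indef_continuous[OF steer_indef[OF u(1)]])
  have i: "indef (\<lambda>t. (1 + u t) / 2) (\<lambda>t. (t + X t) / 2)"
    using indef_cmult[OF indef_add[OF indef_id steer_indef[OF u(1)]], of "1 / 2"] by simp
  show ?thesis
  proof (rule that[OF i _ _ _ _ _ _ _ _ _ rotated_moments[OF u m]])
    show "(1 + u t) / 2 \<ge> 0" if "0 \<le> t" "t \<le> 1" for t
    proof -
      have "\<bar>u t\<bar> \<le> 1" using u(1) that by (simp add: steer_def)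
      then show ?thesis by (simp add: abs_le_iff)
    qed
    show "continuous_on {0..1} (\<lambda>t. (t + X t) / 2)"
      "continuous_on {0..1} (\<lambda>t. (1 - a) / 2 - (t - X t) / 2)"
      by (intro continuous_intros X; simp)+
    show "(s + X s) / 2 \<le> (t + X t) / 2" "(1 - a) / 2 - (t - X t) / 2 \<le> (1 - a) / 2 - (s - X s) / 2"
      if "0 \<le> s" "s \<le> t" "t \<le> 1" for s t
      using inc[OF that] by (simp_all add: abs_le_iff field_simps)
    show "(t + X t) / 2 \<in> {0..1}" "(1 - a) / 2 - (t - X t) / 2 \<in> {0..(1 - a) / 2}"
      if "0 \<le> t" "t \<le> 1" for t
      using inc[of 0 t] inc[of t 1] that X0 u(2) by (auto simp: abs_le_iff field_simps)
  qed (use X0 u(2) in auto)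
qed

lemma reach_area_nonneg:
  assumes "reach a z w v"
  shows "0 \<le> area a z"
  by (rule reach_profile[OF assms])
    (rule has_integral_nonneg, assumption, simp)

text \<open>Reflecting the path replaces the area of the region by that of its complement in the
  rectangle; both are nonnegative.\<close>

lemma reach_abs_z:
  assumes "reach a z w v"
  shows "\<bar>z\<bar> \<le> z_max a"
  using reach_area_nonneg[OF assms] reach_area_nonneg[OF reach_reflect[OF assms]]
  by (auto simp: area_def z_max_def abs_le_iff)

text \<open>With width P and area N the bound on w reads 2 M - 2 M' <= N (P - N / P), the form in
  which it is proved and used. At \<open>a = -1\<close> both area and \<open>z\<close> vanish, and
  the quotients by 0 are 0.\<close>

lemma w_max_iff:
  assumes "\<bar>a\<bar> \<le> 1" "\<bar>z\<bar> \<le> z_max a"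
  shows "w \<le> w_max a z \<longleftrightarrow> 2 * skew a z w \<le> area a z * ((1 + a) / 2 - area a z / ((1 + a) / 2))"
proof -
  have "area a z * ((1 + a) / 2 - area a z / ((1 + a) / 2)) - 2 * skew a z w = w_max a z - w"
  proof (cases "a = -1")
    case True
    then show ?thesis using assms(2) by (simp add: area_def skew_def w_max_def z_max_def field_simps)
  next
    case False
    then have "1 + a \<noteq> 0" by auto
    then show ?thesis
      by (simp add: area_def skew_def w_max_def divide_simps) (simp add: algebra_simps power2_eq_square power3_eq_cube)
  qed
  then show ?thesis by linarith
qed

text \<open>Two estimates are combined: Chebyshev's inequality for the oppositely monotone
  \<open>\<xi>\<close> and \<open>\<beta>\<close> gives \<open>M \<le> P * N / 2\<close>, and
  nonnegativity of the variance of \<open>\<beta>\<close> gives \<open>N * (N / P) \<le> K\<close>,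
  where \<open>K\<close> is 2 M'.\<close>

lemma reach_w_le:
  assumes "reach a z w v"
  shows "w \<le> w_max a z"
proof (rule reach_profile[OF assms])
  fix \<rho> \<xi> \<beta> :: "real \<Rightarrow> real"
  define P N M K where "P = (1 + a) / 2" and "N = area a z"
    and "M = ((v - base a z) / 2 + skew a z w) / 2" and "K = (v - base a z) / 2 - skew a z w"
  assume \<rho>0: "\<And>t. 0 \<le> t \<Longrightarrow> t \<le> 1 \<Longrightarrow> \<rho> t \<ge> 0"
    and cont: "continuous_on {0..1} \<xi>"
    and mono: "\<And>s t. 0 \<le> s \<Longrightarrow> s \<le> t \<Longrightarrow> t \<le> 1 \<Longrightarrow> \<xi> s \<le> \<xi> t"
      "\<And>s t. 0 \<le> s \<Longrightarrow> s \<le> t \<Longrightarrow> t \<le> 1 \<Longrightarrow> \<beta> t \<le> \<beta> s"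
    and e: "\<xi> 0 = 0" "\<xi> 1 = (1 + a) / 2"
    and i: "(\<rho> has_integral (1 + a) / 2) {0..1}"
    "((\<lambda>t. \<xi> t * \<rho> t) has_integral ((1 + a) / 2)\<^sup>2 / 2) {0..1}"
    "((\<lambda>t. \<beta> t * \<rho> t) has_integral area a z) {0..1}"
    "((\<lambda>t. \<xi> t * \<beta> t * \<rho> t) has_integral ((v - base a z) / 2 + skew a z w) / 2) {0..1}"
    "((\<lambda>t. (\<beta> t)\<^sup>2 * \<rho> t) has_integral ((v - base a z) / 2 - skew a z w)) {0..1}"
  note i = i[folded P_def N_def M_def K_def]
  have P: "P \<ge> 0" using mono(1)[of 0 1] e by (simp add: P_def)
  \<comment> \<open>At \<open>r\<close> the function \<open>\<xi>\<close> takes its mean value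
    \<open>P / 2\<close>, so the term with \<open>\<beta> r\<close> integrates to zero.\<close>
  obtain r where r: "0 \<le> r" "r \<le> 1" "\<xi> r = P / 2"
    using IVT'[of \<xi> 0 "P / 2" 1] cont e P by (auto simp: P_def)
  have "((\<lambda>t. P / 2 * (\<beta> t * \<rho> t) + \<beta> r * (\<xi> t * \<rho> t) - P / 2 * \<beta> r * \<rho> t - \<xi> t * \<beta> t * \<rho> t)
     has_integral (P / 2 * N + \<beta> r * (P\<^sup>2 / 2) - P / 2 * \<beta> r * P - M)) {0..1}"
    by (intro has_integral_add has_integral_diff has_integral_mult_right i)
  then have "0 \<le> P / 2 * N + \<beta> r * (P\<^sup>2 / 2) - P / 2 * \<beta> r * P - M"
  proof (rule has_integral_nonneg)
    fix t :: real assume t: "t \<in> {0..1}"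
    have "0 \<le> (\<xi> t - \<xi> r) * (\<beta> r - \<beta> t)"
      using mono[of t r] mono[of r t] r t by (cases "t \<le> r") (auto intro: mult_nonpos_nonpos)
    then have "0 \<le> (\<xi> t - P / 2) * (\<beta> r - \<beta> t) * \<rho> t" using \<rho>0 t r by simp
    then show "0 \<le> P / 2 * (\<beta> t * \<rho> t) + \<beta> r * (\<xi> t * \<rho> t) - P / 2 * \<beta> r * \<rho> t - \<xi> t * \<beta> t * \<rho> t"
      by (simp add: algebra_simps diff_divide_distrib)
  qed
  then have M: "M \<le> P * N / 2" by (simp add: power2_eq_square algebra_simps)
  have "((\<lambda>t. (\<beta> t)\<^sup>2 * \<rho> t - 2 * (N / P) * (\<beta> t * \<rho> t) + (N / P)\<^sup>2 * \<rho> t)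
     has_integral (K - 2 * (N / P) * N + (N / P)\<^sup>2 * P)) {0..1}"
    by (intro has_integral_add has_integral_diff has_integral_mult_right i)
  then have "0 \<le> K - 2 * (N / P) * N + (N / P)\<^sup>2 * P"
  proof (rule has_integral_nonneg)
    fix t :: real assume t: "t \<in> {0..1}"
    have "0 \<le> (\<beta> t - N / P)\<^sup>2 * \<rho> t" using \<rho>0 t by simp
    then show "0 \<le> (\<beta> t)\<^sup>2 * \<rho> t - 2 * (N / P) * (\<beta> t * \<rho> t) + (N / P)\<^sup>2 * \<rho> t"
      by (simp add: algebra_simps power2_eq_square)
  qed
  moreover have "(N / P)\<^sup>2 * P = N * (N / P)" by (simp add: power2_eq_square)
  ultimately have K: "N * (N / P) \<le> K" by (simp add: mult.commute)
  have "2 * skew a z w = 2 * M - K" by (simp add: M_def K_def field_simps)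
  also have "\<dots> \<le> N * (P - N / P)" using M K by (simp add: algebra_simps)
  finally show ?thesis
    using w_max_iff[OF reach_abs_le[OF assms] reach_abs_z[OF assms]] by (simp add: P_def N_def)
qed

text \<open>The inequality is 4 M M' <= \<open>N ^ 3\<close>. It is the mean difference bound for
  \<open>\<beta>\<close> rescaled to mean 0; \<open>z \<ge> 0\<close> is what keeps the rescaled
  function within [-1, 1].\<close>

lemma reach_moment_product:
  assumes "reach a z w v" "z \<ge> 0"
  shows "((v - base a z) / 2 + skew a z w) * ((v - base a z) / 2 - skew a z w) \<le> area a z ^ 3"
proof (rule reach_profile[OF assms(1)])
  fix \<rho> \<xi> \<beta> :: "real \<Rightarrow> real"
  define P N M K where "P = (1 + a) / 2" and "N = area a z"
    and "M = ((v - base a z) / 2 + skew a z w) / 2" and "K = (v - base a z) / 2 - skew a z w"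
  assume \<rho>: "indef \<rho> \<xi>" and \<rho>0: "\<And>t. 0 \<le> t \<Longrightarrow> t \<le> 1 \<Longrightarrow> \<rho> t \<ge> 0"
    and cont: "continuous_on {0..1} \<xi>" "continuous_on {0..1} \<beta>"
    and mono: "\<And>s t. 0 \<le> s \<Longrightarrow> s \<le> t \<Longrightarrow> t \<le> 1 \<Longrightarrow> \<beta> t \<le> \<beta> s"
    and \<xi>: "\<And>t. 0 \<le> t \<Longrightarrow> t \<le> 1 \<Longrightarrow> \<xi> t \<in> {0..1}"
    and \<beta>: "\<And>t. 0 \<le> t \<Longrightarrow> t \<le> 1 \<Longrightarrow> \<beta> t \<in> {0..(1 - a) / 2}"
    and e: "\<xi> 1 = (1 + a) / 2"
    and i: "(\<rho> has_integral (1 + a) / 2) {0..1}"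
    "((\<lambda>t. \<xi> t * \<rho> t) has_integral ((1 + a) / 2)\<^sup>2 / 2) {0..1}"
    "((\<lambda>t. \<beta> t * \<rho> t) has_integral area a z) {0..1}"
    "((\<lambda>t. \<xi> t * \<beta> t * \<rho> t) has_integral ((v - base a z) / 2 + skew a z w) / 2) {0..1}"
    "((\<lambda>t. (\<beta> t)\<^sup>2 * \<rho> t) has_integral ((v - base a z) / 2 - skew a z w)) {0..1}"
  note i = i[folded P_def N_def M_def K_def]
  have a: "\<bar>a\<bar> \<le> 1" by (rule reach_abs_le[OF assms(1)])
  have P0: "P \<ge> 0" using a by (auto simp: P_def)
  have N0: "N \<ge> 0" using reach_area_nonneg[OF assms(1)] by (simp add: N_def)
  \<comment> \<open>Hence for \<open>z \<ge> 0\<close> the region fills at least half of the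
    rectangle, so its mean height \<open>N / P\<close> is at least half of the full height.\<close>
  have NP: "2 * N = z + P * ((1 - a) / 2)"
    by (simp add: N_def P_def area_def field_simps power2_eq_square)
  have "2 * M * K \<le> N ^ 3"
  proof (cases "N = 0")
    case True
    have "M \<le> N"
    proof (rule has_integral_le[OF i(4) i(3)])
      fix t :: real assume "t \<in> {0..1}"
      then show "\<xi> t * \<beta> t * \<rho> t \<le> \<beta> t * \<rho> t"
        using \<xi>[of t] \<beta>[of t] \<rho>0[of t] by (auto intro!: mult_right_mono mult_left_le_one_le)
    qed
    moreover have "M \<ge> 0"
      by (rule has_integral_nonneg[OF i(4)]) (use \<xi> \<beta> \<rho>0 in force)
    ultimately show ?thesis using True by simp
  next
    case False
    then have N: "N > 0" using N0 by simp
    have "N \<le> P"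
    proof (rule has_integral_le[OF i(3) i(1)])
      fix t :: real assume t: "t \<in> {0..1}"
      have "\<beta> t \<le> 1" "\<beta> t \<ge> 0" using \<beta>[of t] t a by (auto simp: abs_le_iff)
      then show "\<beta> t * \<rho> t \<le> \<rho> t" using \<rho>0[of t] t by (auto intro: mult_left_le_one_le)
    qed
    then have P: "P > 0" using N by simp
    \<comment> \<open>Dividing \<open>\<beta>\<close> by its mean \<open>N / P\<close> and
      subtracting 1 centres it. Its variance \<open>S\<close> satisfies
      \<open>1 + S = K * P / N\<^sup>2\<close>, which turns the mean difference bound into the
      product inequality.\<close>
    define f where "f = (\<lambda>t. P / N * \<beta> t - 1)"
    define S where "S = K * P / N\<^sup>2 - 1"
    have "((\<lambda>t. P / N * (\<beta> t * \<rho> t) - \<rho> t) has_integral (P / N * N - P)) {0..1}"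
      by (intro has_integral_diff has_integral_mult_right i)
    then have f1: "((\<lambda>t. f t * \<rho> t) has_integral 0) {0..1}"
      using N by (simp add: f_def algebra_simps)
    have "((\<lambda>t. (P / N)\<^sup>2 * ((\<beta> t)\<^sup>2 * \<rho> t) - 2 * (P / N) * (\<beta> t * \<rho> t) + \<rho> t)
        has_integral ((P / N)\<^sup>2 * K - 2 * (P / N) * N + P)) {0..1}"
      by (intro has_integral_add has_integral_diff has_integral_mult_right i)
    moreover have "(P / N)\<^sup>2 * K - 2 * (P / N) * N + P = S * P"
      using N by (simp add: S_def field_simps power2_eq_square)
    ultimately have f2: "((\<lambda>t. (f t)\<^sup>2 * \<rho> t) has_integral S * P) {0..1}"
      by (simp add: f_def algebra_simps power2_eq_square)
    have "((\<lambda>t. P / N * (\<xi> t * \<beta> t * \<rho> t) - \<xi> t * \<rho> t) has_integral (P / N * M - P\<^sup>2 / 2)) {0..1}"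
      by (intro has_integral_diff has_integral_mult_right i)
    then have f3: "((\<lambda>t. \<xi> t * f t * \<rho> t) has_integral (P / N * M - P\<^sup>2 / 2)) {0..1}"
      by (simp add: f_def algebra_simps)
    have "S * P\<^sup>2 \<le> - 2 * (P / N * M - P\<^sup>2 / 2) * (1 + S)"
    proof (rule gini_mean_difference_bound[OF \<rho> \<rho>0 _ _ _ _ P f1 f2 f3])
      show "continuous_on {0..1} f" unfolding f_def by (intro continuous_intros cont)
      show "f t \<le> f s" if "0 \<le> s" "s \<le> t" "t \<le> 1" for s t
        unfolding f_def using mono[OF that] P N by (intro diff_right_mono mult_left_mono) auto
      show "\<bar>f t\<bar> \<le> 1" if "0 \<le> t" "t \<le> 1" for t
      proof -
        have "P * \<beta> t \<le> P * ((1 - a) / 2)" using \<beta>[OF that] P by (intro mult_left_mono) auto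
        then have "P * \<beta> t \<le> 2 * N" using NP assms(2) by simp
        moreover have "0 \<le> P / N * \<beta> t" using \<beta>[OF that] P N by simp
        ultimately show ?thesis using N by (simp add: f_def abs_le_iff field_simps)
      qed
      show "\<xi> 1 = P" using e by (simp add: P_def)
    qed
    then have "P\<^sup>2 * (2 * M * K) \<le> P\<^sup>2 * N ^ 3"
      using P N by (simp add: S_def field_simps power2_eq_square power3_eq_cube)
    then show ?thesis using P by simp
  qed
  moreover have "2 * M = (v - base a z) / 2 + skew a z w" by (simp add: M_def)
  ultimately show ?thesis by (simp add: K_def N_def)
qed

text \<open>The larger root v of 4 M M' = \<open>N ^ 3\<close>, where M + M' = (v - base) / 2 and M
  - M' is the skew. The constants fit because 4608 = 9 * 512 = 8 * 576 and 2 * 4608 = 96 *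
  96.\<close>

lemma v_max_pos_eq:
  assumes "area a z \<ge> 0"
  shows "v_max_pos a z w = base a z + 2 * sqrt (area a z ^ 3 + (skew a z w)\<^sup>2)"
proof -
  have "9 * (1 - a\<^sup>2 + 4 * z) ^ 3 + 8 * (12 * w + 3 * a + a ^ 3 - 6 * (1 - a) * z)\<^sup>2
      = 4608 * (area a z ^ 3 + (skew a z w)\<^sup>2)"
    by (simp add: area_def skew_def power_divide)
  moreover have "sqrt 2 * sqrt (4608 * (area a z ^ 3 + (skew a z w)\<^sup>2))
      = sqrt (96\<^sup>2 * (area a z ^ 3 + (skew a z w)\<^sup>2))"
    by (simp flip: real_sqrt_mult)
  moreover have "\<dots> = 96 * sqrt (area a z ^ 3 + (skew a z w)\<^sup>2)"
    by (simp only: real_sqrt_mult real_sqrt_abs abs_numeral)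
  ultimately show ?thesis by (simp add: v_max_pos_def base_def)
qed

lemma reach_v_le_pos:
  assumes "reach a z w v" "z \<ge> 0"
  shows "v \<le> v_max_pos a z w"
proof -
  have "((v - base a z) / 2)\<^sup>2 \<le> area a z ^ 3 + (skew a z w)\<^sup>2"
    using reach_moment_product[OF assms] by (simp add: algebra_simps power2_eq_square)
  then have "(v - base a z) / 2 \<le> sqrt (area a z ^ 3 + (skew a z w)\<^sup>2)"
    by (rule real_le_rsqrt)
  then show ?thesis using v_max_pos_eq[OF reach_area_nonneg[OF assms(1)]] by simp
qed

lemma reach_v_le:
  assumes "reach a z w v"
  shows "v \<le> v_max a z w"
  using reach_v_le_pos[OF assms] reach_v_le_pos[OF reach_reflect[OF assms]]
  by (cases "z \<ge> 0") (auto simp: v_max_def sg_def)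

section \<open>Piecewise linear paths\<close>

text \<open>A path on [0, s] together with its accumulated moments, so that linear pieces can be
  appended one after another. \<open>X\<close> is given in advance on the whole line; the control is
  existential because every extension redefines it beyond \<open>s\<close>.\<close>

definition partial_path :: "(real \<Rightarrow> real) \<Rightarrow> real \<Rightarrow> real \<Rightarrow> real \<Rightarrow> real \<Rightarrow> bool" where
  "partial_path X s A B C \<longleftrightarrow> s \<ge> 0 \<and>
     (\<exists>u. \<forall>t\<in>{0..s}. \<bar>u t\<bar> \<le> 1 \<and> (u has_integral X t) {0..t}) \<and>
     (X has_integral A) {0..s} \<and> ((\<lambda>t. t * X t) has_integral B) {0..s} \<and>
     ((\<lambda>t. (X t)\<^sup>2) has_integral C) {0..s}"

lemma partial_path_start: "X 0 = 0 \<Longrightarrow> partial_path X 0 0 0 0"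
  unfolding partial_path_def by (auto intro!: exI[of _ "\<lambda>_. 0"])

lemma has_integral_shifted_quadratic:
  fixes s L k0 k1 k2 :: real
  assumes "L \<ge> 0"
  shows "((\<lambda>t. k0 + k1 * (t - s) + k2 * (t - s)\<^sup>2) has_integral
      (k0 * L + k1 * L\<^sup>2 / 2 + k2 * L ^ 3 / 3)) {s..s + L}"
proof -
  let ?F = "\<lambda>t. k0 * (t - s) + k1 * (t - s)\<^sup>2 / 2 + k2 * (t - s) ^ 3 / 3"
  have "((\<lambda>t. k0 + k1 * (t - s) + k2 * (t - s)\<^sup>2) has_integral (?F (s + L) - ?F s)) {s..s + L}"
    by (rule fundamental_theorem_of_calculus)
      (use assms in \<open>auto intro!: derivative_eq_intros
        simp: has_real_derivative_iff_has_vector_derivative[symmetric] field_simps power2_eq_square\<close>)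
  then show ?thesis by simp
qed

lemma has_integral_append:
  fixes f g h :: "real \<Rightarrow> real"
  assumes "(f has_integral i) {a..b}" "(g has_integral j) {b..c}" "a \<le> b" "b \<le> c"
    and "\<And>t. a \<le> t \<Longrightarrow> t \<le> b \<Longrightarrow> h t = f t" "\<And>t. b < t \<Longrightarrow> t \<le> c \<Longrightarrow> h t = g t"
    and "k = i + j"
  shows "(h has_integral k) {a..c}"
proof -
  have "(h has_integral i) {a..b}"
    by (rule has_integral_eq[OF _ assms(1)]) (use assms in auto)
  moreover have "(h has_integral j) {b..c}"
    by (rule has_integral_spike_finite[of "{b}" _ _ g]) (use assms in auto)
  ultimately show ?thesis unfolding assms(7) by (rule has_integral_combine[OF assms(3,4)])
qed

text \<open>The increment \<open>d\<close> is a parameter besides the slope \<open>m\<close>, so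
  that the new moments are polynomials even when the slope is a quotient.\<close>

lemma partial_path_extend:
  assumes "partial_path X s A B C" "L \<ge> 0" "\<bar>m\<bar> \<le> 1" and x: "X s = x" and d: "m * L = d"
    and X: "\<And>t. s \<le> t \<Longrightarrow> t \<le> s + L \<Longrightarrow> X t = x + m * (t - s)"
  shows "partial_path X (s + L) (A + x * L + d * L / 2)
       (B + s * x * L + x * L\<^sup>2 / 2 + s * d * L / 2 + d * L\<^sup>2 / 3)
       (C + x\<^sup>2 * L + x * d * L + d\<^sup>2 * L / 3)"
proof -
  note p = assms(1)[unfolded partial_path_def]
  from p obtain u where "\<forall>t\<in>{0..s}. \<bar>u t\<bar> \<le> 1 \<and> (u has_integral X t) {0..t}"
    by (elim conjE exE)
  then have u: "\<And>t. 0 \<le> t \<Longrightarrow> t \<le> s \<Longrightarrow> \<bar>u t\<bar> \<le> 1 \<and> (u has_integral X t) {0..t}"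
    by simp
  define u' where "u' = (\<lambda>t. if t \<le> s then u t else m)"
  have "(u' has_integral X t) {0..t}" if t: "0 \<le> t" "t \<le> s + L" for t
  proof (cases "t \<le> s")
    case True
    show ?thesis
      by (rule has_integral_eq[of "{0..t}" u u' "X t", rotated]) (use True u t in \<open>auto simp: u'_def\<close>)
  next
    case False
    have m: "((\<lambda>_. m) has_integral m * (t - s)) {s..t}"
      using has_integral_const_real[of m s t] False by (simp add: mult.commute)
    have x: "(u has_integral x) {0..s}" using u[of s] p x by auto
    show ?thesis
      by (rule has_integral_append[OF x m]) (use False p t X[of t] in \<open>auto simp: u'_def\<close>)
  qed
  moreover have "\<bar>u' t\<bar> \<le> 1" if "0 \<le> t" for t using that u assms(3) by (auto simp: u'_def)
  ultimately have "\<exists>u. \<forall>t\<in>{0..s + L}. \<bar>u t\<bar> \<le> 1 \<and> (u has_integral X t) {0..t}"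
    by (intro exI[of _ u']) auto
  moreover have "(X has_integral (A + x * L + d * L / 2)) {0..s + L}"
    by (rule has_integral_append[OF _ has_integral_shifted_quadratic[OF assms(2), of x m s 0]])
      (use p assms(2) X in \<open>auto simp: d[symmetric] power2_eq_square\<close>)
  moreover have "((\<lambda>t. t * X t) has_integral
      (B + s * x * L + x * L\<^sup>2 / 2 + s * d * L / 2 + d * L\<^sup>2 / 3)) {0..s + L}"
  proof (rule has_integral_append[OF _ has_integral_shifted_quadratic[OF assms(2),
        of "s * x" "x + s * m" s m], of "\<lambda>t. t * X t" B])
    fix t assume t: "s < t" "t \<le> s + L"
    show "t * X t = s * x + (x + s * m) * (t - s) + m * (t - s)\<^sup>2"
      using t by (simp add: X algebra_simps power2_eq_square)
  qed (use p assms(2) in \<open>auto simp: d[symmetric] power2_eq_square power3_eq_cube field_simps\<close>)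
  moreover have "((\<lambda>t. (X t)\<^sup>2) has_integral (C + x\<^sup>2 * L + x * d * L + d\<^sup>2 * L / 3)) {0..s + L}"
  proof (rule has_integral_append[OF _ has_integral_shifted_quadratic[OF assms(2),
        of "x\<^sup>2" "2 * x * m" s "m\<^sup>2"], of "\<lambda>t. (X t)\<^sup>2" C])
    fix t assume t: "s < t" "t \<le> s + L"
    show "(X t)\<^sup>2 = x\<^sup>2 + 2 * x * m * (t - s) + m\<^sup>2 * (t - s)\<^sup>2"
      using t by (simp add: X algebra_simps power2_eq_square)
  qed (use p assms(2) in \<open>auto simp: d[symmetric] power2_eq_square power3_eq_cube field_simps\<close>)
  ultimately show ?thesis
    unfolding partial_path_def using p assms(2) by auto
qed

lemma partial_path_cong:
  "s = s' \<Longrightarrow> A = A' \<Longrightarrow> B = B' \<Longrightarrow> C = C' \<Longrightarrow> partial_path X s A B C \<Longrightarrow> partial_path X s' A' B' C'"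
  by simp

lemma partial_path_one:
  assumes "partial_path X 1 A B C"
  shows "\<exists>u. steer u X \<and> moments X A B C"
proof -
  from assms[unfolded partial_path_def]
  obtain u where u: "\<forall>t\<in>{0..1}. \<bar>u t\<bar> \<le> 1 \<and> (u has_integral X t) {0..t}"
    by (elim conjE exE)
  then have "steer u X" unfolding steer_def indef_def by (intro conjI exI[of _ 1]) simp_all
  moreover have "moments X A B C" using assms by (simp add: partial_path_def moments_def)
  ultimately show ?thesis by blast
qed

text \<open>Here the region in characteristic coordinates is a rectangle with sides \<open>p\<close> and \<open>q\<close>.\<close>

lemma reach_zigzag:
  assumes "0 \<le> p" "p \<le> P" "0 \<le> q" "q \<le> 1 - P"
    and a: "a = 2 * P - 1" and N: "area a z = p * q" and D: "2 * skew a z w = p * q * (p - q)"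
  shows "reach a z w (base a z + p * q * (p + q))"
proof -
  \<comment> \<open>Slopes -1, 1, -1, 1: the profile falls from 1 - P to q, stays there while
    \<open>\<xi>\<close> grows to p, falls to 0 and remains there.\<close>
  define X where "X = (\<lambda>t. if t \<le> 1 - P - q then - t else if t \<le> 1 - P - q + p then t - 2 * (1 - P - q)
      else if t \<le> 1 - P + p then 2 * p - t else t + 2 * P - 2)"
  have 0: "partial_path X 0 0 0 0"
    by (rule partial_path_start) (use assms in \<open>auto simp: X_def\<close>)
  note 1 = partial_path_extend[OF 0, of "1 - P - q" "-1" 0 "- (1 - P - q)"]
  note 2 = partial_path_extend[OF 1, of p 1 "- (1 - P - q)" p]
  note 3 = partial_path_extend[OF 2, of q "-1" "- (1 - P - q) + p" "- q"]
  note 4 = partial_path_extend[OF 3, of "P - p" 1 "- (1 - P - q) + p - q" "P - p"]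
  have z: "z = 2 * p * q - P * (1 - P)"
    using N by (simp add: area_def a power2_eq_square algebra_simps)
  have w: "w = p * q * (p - q) - a / 4 - a ^ 3 / 12 + (1 - a) * z / 2"
    using D by (simp add: skew_def field_simps)
  have "partial_path X 1 (z + a / 2) (w + a ^ 3 / 6 + a / 2) (2 * (base a z + p * q * (p + q)) - 1 / 3)"
    using assms(1-4)
    apply (intro partial_path_cong[OF _ _ _ _ 4])
    subgoal by simp
    subgoal by (simp add: z a field_simps power2_eq_square)
    subgoal by (simp add: w z a field_simps power2_eq_square power3_eq_cube)
    subgoal by (simp add: base_def z a field_simps power2_eq_square power3_eq_cube)
    by (auto simp: X_def)
  moreover have "X 1 = a" using assms(1-4) a by (auto simp: X_def)
  ultimately show ?thesis unfolding reach_def using partial_path_one by blast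
qed

text \<open>Because the first two moments agree, the line \<open>k + m * t\<close> can be inserted
  freely: the integral of \<open>Y\<^sup>2 - X\<^sup>2\<close> equals that of
  \<open>(Y - X)\<^sup>2\<close> plus twice that of the product in the sign condition.\<close>

lemma optimal_path:
  assumes X: "moments X A B C" and Y: "moments Y A B C'"
    and sign: "\<And>t. 0 \<le> t \<Longrightarrow> t \<le> 1 \<Longrightarrow> 0 \<le> (X t - (k + m * t)) * (Y t - X t)"
  shows "C \<le> C'"
proof -
  have "((\<lambda>t. (Y t)\<^sup>2 - (X t)\<^sup>2 - 2 * k * (Y t - X t) - 2 * m * (t * Y t - t * X t)) has_integral
      (C' - C - 2 * k * (A - A) - 2 * m * (B - B))) {0..1}"
    using X Y unfolding moments_def
    by (intro has_integral_diff has_integral_mult_right) auto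
  then have "0 \<le> C' - C - 2 * k * (A - A) - 2 * m * (B - B)"
  proof (rule has_integral_nonneg)
    fix t :: real assume t: "t \<in> {0..1}"
    have "(Y t)\<^sup>2 - (X t)\<^sup>2 - 2 * k * (Y t - X t) - 2 * m * (t * Y t - t * X t)
        = (Y t - X t)\<^sup>2 + 2 * ((X t - (k + m * t)) * (Y t - X t))"
      by (simp add: algebra_simps power2_eq_square)
    then show "0 \<le> (Y t)\<^sup>2 - (X t)\<^sup>2 - 2 * k * (Y t - X t) - 2 * m * (t * Y t - t * X t)"
      using sign[of t] t by simp
  qed
  then show ?thesis by simp
qed

section \<open>Minimizers with a straight middle segment\<close>

definition least :: "real \<Rightarrow> real \<Rightarrow> real \<Rightarrow> real \<Rightarrow> bool" where
  "least a z w v \<longleftrightarrow> reach a z w v \<and> (\<forall>v'. reach a z w v' \<longrightarrow> v \<le> v')"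

text \<open>Slope 1 for time \<open>L1\<close>, a segment with increment \<open>d\<close> for time
  \<open>L\<close>, slope \<open>e\<close> for time \<open>L3\<close>. On the outer arcs
  \<open>X\<close> is the extreme value compatible with X 0 = 0 or X 1 = a, which fixes the sign of
  Y - X there; on the segment \<open>X\<close> coincides with the comparison line. The three long
  equations are the accumulated moments.\<close>

lemma least_three_arcs:
  assumes L: "L1 \<ge> 0" "L \<ge> 0" "L3 \<ge> 0" "L1 + L + L3 = 1" and d: "\<bar>d\<bar> \<le> L"
    and e: "e = 1 \<or> e = - 1"
    and a: "a = L1 + d + e * L3"
    and z: "z + a / 2 = L1\<^sup>2 / 2 + L1 * L + d * L / 2 + (L1 + d) * L3 + e * L3\<^sup>2 / 2"
    and w: "w + a ^ 3 / 6 + a / 2 = L1 ^ 3 / 3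
      + L1\<^sup>2 * L + L1 * L\<^sup>2 / 2 + L1 * d * L / 2 + d * L\<^sup>2 / 3
      + (L1 + L) * (L1 + d) * L3 + (L1 + d) * L3\<^sup>2 / 2 + (L1 + L) * e * L3\<^sup>2 / 2 + e * L3 ^ 3 / 3"
    and v: "2 * v - 1 / 3 = L1 ^ 3 / 3 + L1\<^sup>2 * L + L1 * d * L + d\<^sup>2 * L / 3
      + (L1 + d)\<^sup>2 * L3 + (L1 + d) * e * L3\<^sup>2 + L3 ^ 3 / 3"
  shows "least a z w v"
proof -
  \<comment> \<open>For \<open>L = 0\<close> the quotient is 0 by convention and
    \<open>d = 0\<close> as well, so \<open>m * L = d\<close> holds in every case.\<close>
  define m where "m = d / L"
  have m: "\<bar>m\<bar> \<le> 1" "m * L = d"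
    using d L by (auto simp: m_def abs_divide divide_le_eq_1 less_eq_real_def)
  have L3: "L3 = 1 - L1 - L" using L(4) by simp
  define X where "X = (\<lambda>t. if t \<le> L1 then t else if t \<le> L1 + L then L1 + m * (t - L1)
      else L1 + d + e * (t - (L1 + L)))"
  have 0: "partial_path X 0 0 0 0"
    by (rule partial_path_start) (use L in \<open>auto simp: X_def\<close>)
  note 1 = partial_path_extend[OF 0, of L1 1 0 L1]
  note 2 = partial_path_extend[OF 1, of L m L1 d]
  note 3 = partial_path_extend[OF 2, of L3 e "L1 + d" "e * L3"]
  have ee: "e * e = 1" using e by auto
  have "partial_path X 1 (z + a / 2) (w + a ^ 3 / 6 + a / 2) (2 * v - 1 / 3)"
    apply (intro partial_path_cong[OF _ _ _ _ 3])
    subgoal using L(4) by simp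
    subgoal unfolding z by (simp add: algebra_simps power2_eq_square)
    subgoal unfolding w by (simp add: algebra_simps power2_eq_square power3_eq_cube)
    subgoal unfolding v using ee by (simp add: algebra_simps power2_eq_square power3_eq_cube)
    using L m e by (auto simp: X_def)
  moreover have X1: "X 1 = a"
  proof (cases "L3 = 0")
    case True
    then have L1: "L1 = 1 - L" using L(4) by simp
    show ?thesis
      using True L m by (cases "L = 0") (auto simp: X_def a L1)
  next
    case False
    then show ?thesis using L m by (cases "L = 0") (auto simp: X_def a L3 algebra_simps)
  qed
  ultimately obtain u where X: "steer u X" "moments X (z + a / 2) (w + a ^ 3 / 6 + a / 2) (2 * v - 1 / 3)"
    using partial_path_one by blast
  have "v \<le> v'" if "reach a z w v'" for v'
  proof -
    obtain u' Y where Y: "steer u' Y" "Y 1 = a"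
      "moments Y (z + a / 2) (w + a ^ 3 / 6 + a / 2) (2 * v' - 1 / 3)"
      using \<open>reach a z w v'\<close> by (auto simp: reach_def)
    have "2 * v - 1 / 3 \<le> 2 * v' - 1 / 3"
    proof (rule optimal_path[OF X(2) Y(3), of "L1 - m * L1" m])
      fix t :: real assume t: "0 \<le> t" "t \<le> 1"
      have Y0: "\<bar>Y t\<bar> \<le> t" and Y1: "\<bar>a - Y t\<bar> \<le> 1 - t"
        using steer_increment[OF Y(1), of 0 t] steer_increment[OF Y(1), of t 1] steer_zero[OF Y(1)] Y(2) t
        by auto
      consider "t \<le> L1" | "L1 < t" "t \<le> L1 + L" | "L1 + L < t" by linarith
      then show "0 \<le> (X t - (L1 - m * L1 + m * t)) * (Y t - X t)"
      proof cases
        case 1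
        then have "X t - (L1 - m * L1 + m * t) = (1 - m) * (t - L1)" "Y t - X t \<le> 0"
          using Y0 by (auto simp: X_def algebra_simps)
        then show ?thesis using m(1) 1 by (auto intro!: mult_nonpos_nonpos mult_nonneg_nonpos)
      next
        case 2
        then show ?thesis by (simp add: X_def algebra_simps)
      next
        case 3
        have eq: "X t - (L1 - m * L1 + m * t) = (e - m) * (t - (L1 + L))"
          using 3 L m(2) by (simp add: X_def algebra_simps)
        have Xt: "X t = a - e * (1 - t)" using 3 L a by (simp add: X_def L3 algebra_simps)
        from e show ?thesis
        proof
          assume "e = 1"
          then show ?thesis unfolding eq using Xt Y1 m(1) 3 by (intro mult_nonneg_nonneg) auto
        next
          assume "e = - 1"
          then show ?thesis unfolding eq using Xt Y1 m(1) 3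
            by (intro mult_nonpos_nonpos mult_nonpos_nonneg) auto
        qed
      qed
    qed
    then show ?thesis by simp
  qed
  moreover have "reach a z w v" unfolding reach_def using X X1 by blast
  ultimately show ?thesis by (simp add: least_def)
qed

section \<open>Attainable values of the moments\<close>

text \<open>The product \<open>p * q\<close> and the difference E / K determine p and q as
  \<open>r + R\<close> and \<open>R - r\<close>. As x - K / x increases with x, the two bounds on
  \<open>E\<close> say exactly that \<open>p \<le> P\<close> and \<open>q \<le> Q\<close>. It serves
  the rectangle of the upper end and the triangle of the lower end.\<close>

lemma factor_with_difference:
  fixes K P Q E :: real
  assumes "0 \<le> K" "0 \<le> P" "0 \<le> Q" "K \<le> P * Q"
    and E: "E \<le> K * (P - K / P)" "- E \<le> K * (Q - K / Q)"
  obtains p q where "0 \<le> p" "p \<le> P" "0 \<le> q" "q \<le> Q" "p * q = K" "K * (p - q) = E"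
proof (cases "K = 0")
  case True
  then show ?thesis using that[of 0 0] assms by simp
next
  case False
  then have K: "K > 0" using assms(1) by simp
  then have "P * Q > 0" using assms(4) by linarith
  then have P: "P > 0" "Q > 0" using assms(2,3) by (auto simp: zero_less_mult_iff)
  define r where "r = E / (2 * K)"
  define R where "R = sqrt (r\<^sup>2 + K)"
  have "\<bar>r\<bar> < R" using K unfolding R_def by (intro real_less_rsqrt) simp
  then have pos: "r + R > 0" "R - r > 0" by auto
  have R2: "R * R = r * r + K" using K by (simp add: R_def power2_eq_square)
  have pq: "(r + R) * (R - r) = K" using R2 by (simp add: algebra_simps)
  have E': "E = K * ((r + R) - (R - r))" using K by (simp add: r_def)
  have le: "x \<le> X" if "x * y = K" "x > 0" "y > 0" "X > 0" "K * (x - y) \<le> K * (X - K / X)" for x y X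
  proof (rule ccontr)
    assume "\<not> x \<le> X"
    then have "X < x" by simp
    then have "K / x < K / X" using K that by (intro divide_strict_left_mono) auto
    moreover have "y = K / x" using that by (simp add: field_simps)
    moreover have "x - y \<le> X - K / X" using that(5) K by simp
    ultimately show False using \<open>X < x\<close> by simp
  qed
  show ?thesis
  proof (rule that[of "r + R" "R - r"])
    show "r + R \<le> P" using le[OF pq pos P(1)] E E' by simp
    show "R - r \<le> Q"
      using le[of "R - r" "r + R" Q] pq pos P(2) E E' by (simp add: algebra_simps)
  qed (use pos pq E' in auto)
qed

section \<open>Attainment of both ends of the interval for v\<close>

definition feasible :: "real \<Rightarrow> real \<Rightarrow> real \<Rightarrow> bool" where
  "feasible a z w \<longleftrightarrow>
     \<bar>a\<bar> \<le> 1 \<and> \<bar>z\<bar> \<le> z_max a \<and> - w_max (- a) (- z) \<le> w \<and> w \<le> w_max a z"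

lemma z_max_uminus [simp]: "z_max (- a) = z_max a"
  by (simp add: z_max_def)

lemma feasible_reflect: "feasible a z w \<Longrightarrow> feasible (- a) (- z) (- w)"
  by (simp add: feasible_def)

lemma reach_feasible:
  assumes "reach a z w v"
  shows "feasible a z w"
  using reach_abs_le[OF assms] reach_abs_z[OF assms] reach_w_le[OF assms]
    reach_w_le[OF reach_reflect[OF assms]]
  by (simp add: feasible_def)

text \<open>The lower bound on w in terms of the same area and skew as in \<open>w_max_iff\<close>,
  with the height of the rectangle in place of its width. Passing to the reflected point instead
  would bring in the area of the complement.\<close>

lemma w_max_reflect_iff:
  assumes "\<bar>a\<bar> \<le> 1" "\<bar>z\<bar> \<le> z_max a"
  shows "- w_max (- a) (- z) \<le> w \<longleftrightarrow>
    - (2 * skew a z w) \<le> area a z * ((1 - a) / 2 - area a z / ((1 - a) / 2))"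
proof -
  have "area a z * ((1 - a) / 2 - area a z / ((1 - a) / 2)) + 2 * skew a z w = w_max (- a) (- z) + w"
  proof (cases "a = 1")
    case True
    then show ?thesis using assms(2) by (simp add: area_def skew_def w_max_def z_max_def field_simps)
  next
    case False
    then have "1 - a \<noteq> 0" by auto
    then show ?thesis
      by (simp add: area_def skew_def w_max_def divide_simps)
        (simp add: algebra_simps power2_eq_square power3_eq_cube)
  qed
  then show ?thesis by linarith
qed

text \<open>The bounds on w are the conditions under which a rectangle with the prescribed area and
  skew fits into the large one. For a rectangle 4 M M' = \<open>N ^ 3\<close> holds with equality,
  so its path attains the upper end.\<close>

lemma reach_v_max_pos:
  assumes f: "feasible a z w" and z: "z \<ge> 0"
  shows "reach a z w (v_max_pos a z w)"
proof -
  define P where "P = (1 + a) / 2"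
  have a: "a = 2 * P - 1" by (simp add: P_def field_simps)
  have P: "0 \<le> P" "0 \<le> 1 - P" using f by (auto simp: feasible_def P_def)
  have N: "2 * area a z = z + P * (1 - P)" by (simp add: area_def a power2_eq_square field_simps)
  have zm: "\<bar>z\<bar> \<le> P * (1 - P)"
    using f by (simp add: feasible_def z_max_def a power2_eq_square algebra_simps)
  have N0: "0 \<le> area a z" and N1: "area a z \<le> P * (1 - P)" using N zm by auto
  have PQ: "(1 + a) / 2 = P" "(1 - a) / 2 = 1 - P" by (simp_all add: P_def field_simps)
  have D: "2 * skew a z w \<le> area a z * (P - area a z / P)"
    "- (2 * skew a z w) \<le> area a z * ((1 - P) - area a z / (1 - P))"
    using f w_max_iff[of a z w] w_max_reflect_iff[of a z w]
    unfolding PQ by (simp_all add: feasible_def)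
  obtain p q where pq: "0 \<le> p" "p \<le> P" "0 \<le> q" "q \<le> 1 - P" "p * q = area a z"
    "area a z * (p - q) = 2 * skew a z w"
    using factor_with_difference[OF N0 P N1 D] .
  have "v_max_pos a z w = base a z + p * q * (p + q)"
  proof -
    have s: "skew a z w = p * q * (p - q) / 2" using pq by simp
    have "area a z ^ 3 + (skew a z w)\<^sup>2 = (p * q * (p + q) / 2)\<^sup>2"
      unfolding pq(5)[symmetric] s by (simp add: power2_eq_square power3_eq_cube field_simps)
    moreover have "0 \<le> p * q * (p + q) / 2" using pq(1,3) by simp
    ultimately have "sqrt (area a z ^ 3 + (skew a z w)\<^sup>2) = p * q * (p + q) / 2"
      by (simp only: real_sqrt_abs abs_of_nonneg)
    then show ?thesis using v_max_pos_eq[OF N0, of w] by simp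
  qed
  then show ?thesis
    using reach_zigzag[OF pq(1-4) a, of z w] pq by simp
qed

lemma reach_v_max:
  assumes "feasible a z w"
  shows "reach a z w (v_max a z w)"
proof (cases "z \<ge> 0")
  case True
  then show ?thesis using reach_v_max_pos[OF assms] by (simp add: v_max_def sg_def)
next
  case False
  then show ?thesis
    using reach_reflect[OF reach_v_max_pos[OF feasible_reflect[OF assms]]]
    by (simp add: v_max_def sg_def)
qed

text \<open>The optimal path cuts off a triangle with legs \<open>p\<close> and \<open>q\<close> from a corner of the rectangle.\<close>

lemma least_v_min_minus:
  assumes f: "feasible a z w" and z: "z \<ge> 0" and w: "- w_mm (- a) (- z) \<le> w" "w \<le> w_mm a z"
  shows "least a z w (v_min_minus a z w)"
proof -
  define P where "P = (1 + a) / 2"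
  have a: "a = 2 * P - 1" by (simp add: P_def field_simps)
  have P: "0 \<le> P" "0 \<le> 1 - P" using f by (auto simp: feasible_def P_def)
  have zm: "\<bar>z\<bar> \<le> P * (1 - P)"
    using f by (simp add: feasible_def z_max_def a power2_eq_square algebra_simps)
  \<comment> \<open>\<open>K\<close> and \<open>E\<close> are the given \<open>z\<close> and
    \<open>w\<close> solved for p q and p q (p - q), where p and q are the legs of the
    triangle.\<close>
  define K where "K = P * (1 - P) - z"
  define E where "E = (12 * w + 3 * a + a ^ 3 - 6 * z - 6 * a * z) / 4"
  have K: "0 \<le> K" "K \<le> P * (1 - P)" using zm z by (auto simp: K_def)
  \<comment> \<open>The two regime boundaries given by \<open>w_mm\<close> express that the legs are
    at most as long as the sides of the rectangle.\<close>
  have "K * (P - K / P) - E = 3 * (w_mm a z - w)"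
  proof (cases "P = 0")
    case True
    then show ?thesis using zm by (simp add: K_def E_def w_mm_def a field_simps)
  next
    case False
    then show ?thesis using z
      by (simp add: K_def E_def w_mm_def a sg_def divide_simps)
        (simp add: algebra_simps power2_eq_square power3_eq_cube)
  qed
  then have E1: "E \<le> K * (P - K / P)" using w by simp
  have "K * ((1 - P) - K / (1 - P)) + E = 3 * (w_mm (- a) (- z) + w)"
  proof (cases "P = 1")
    case True
    then show ?thesis using zm by (simp add: K_def E_def w_mm_def a field_simps)
  next
    case False
    then have "2 - 2 * P \<noteq> 0" "1 - P \<noteq> 0" by auto
    then show ?thesis using z
      by (simp add: K_def E_def w_mm_def a sg_def divide_simps)
        (simp add: algebra_simps power2_eq_square power3_eq_cube)
  qed
  then have E2: "- E \<le> K * ((1 - P) - K / (1 - P))" using w by simp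
  obtain p q where pq: "0 \<le> p" "p \<le> P" "0 \<le> q" "q \<le> 1 - P" "p * q = K" "K * (p - q) = E"
    using factor_with_difference[OF K(1) P K(2) E1 E2] .
  have zK: "z = P * (1 - P) - p * q" using pq by (simp add: K_def)
  have wE: "w = p * q * (p - q) / 3 - (3 * a + a ^ 3 - 6 * z - 6 * a * z) / 12"
    using pq by (simp add: E_def field_simps)
  have "v_min_minus a z w = base a z + z + p * q * (p + q) / 3"
  proof -
    have pos: "0 \<le> 4 * (p * q * (p + q))" using pq(1,3) by simp
    \<comment> \<open>The radicand becomes a perfect square: \<open>E\<^sup>2 + 4 * K ^ 3\<close> is
      \<open>K\<^sup>2 * (p + q)\<^sup>2\<close>.\<close>
    have "(1 - 12 * w - 2 * a - a\<^sup>2 - 2 * a ^ 3 + 2 * (1 + a) * z)\<^sup>2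
           + 4 * (1 - a\<^sup>2 - 4 * z)
               * ((1 + a) * (6 * w + a + a ^ 3) - 4 * (1 + a) * z + 4 * z\<^sup>2) = 16 * (E\<^sup>2 + 4 * K ^ 3)"
      unfolding E_def K_def a by (simp add: field_simps power2_eq_square power3_eq_cube)
    also have "\<dots> = (4 * (p * q * (p + q)))\<^sup>2"
      unfolding pq(5,6)[symmetric] by (simp add: algebra_simps power2_eq_square power3_eq_cube)
    finally have "sqrt ((1 - 12 * w - 2 * a - a\<^sup>2 - 2 * a ^ 3 + 2 * (1 + a) * z)\<^sup>2
           + 4 * (1 - a\<^sup>2 - 4 * z)
               * ((1 + a) * (6 * w + a + a ^ 3) - 4 * (1 + a) * z + 4 * z\<^sup>2)) = 4 * (p * q * (p + q))"
      using pos by (simp only: real_sqrt_abs abs_of_nonneg)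
    then show ?thesis
      unfolding v_min_minus_def base_def by (simp add: field_simps)
  qed
  \<comment> \<open>The hypotenuse is traversed in time p + q with increment p - q; before it the
    path has slope 1, after it slope -1.\<close>
  moreover have "least a z w (base a z + z + p * q * (p + q) / 3)"
  proof (rule least_three_arcs[of "P - p" "p + q" "1 - P - q" "p - q" "- 1"])
    show "w + a ^ 3 / 6 + a / 2 = (P - p) ^ 3 / 3
      + (P - p)\<^sup>2 * (p + q) + (P - p) * (p + q)\<^sup>2 / 2 + (P - p) * (p - q) * (p + q) / 2 + (p - q) * (p + q)\<^sup>2 / 3
      + (P - p + (p + q)) * (P - p + (p - q)) * (1 - P - q) + (P - p + (p - q)) * (1 - P - q)\<^sup>2 / 2
      + (P - p + (p + q)) * - 1 * (1 - P - q)\<^sup>2 / 2 + - 1 * (1 - P - q) ^ 3 / 3"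
      unfolding wE zK a by (simp add: field_simps power2_eq_square power3_eq_cube)
    show "2 * (base a z + z + p * q * (p + q) / 3) - 1 / 3 = (P - p) ^ 3 / 3 + (P - p)\<^sup>2 * (p + q)
      + (P - p) * (p - q) * (p + q) + (p - q)\<^sup>2 * (p + q) / 3
      + (P - p + (p - q))\<^sup>2 * (1 - P - q) + (P - p + (p - q)) * - 1 * (1 - P - q)\<^sup>2 + (1 - P - q) ^ 3 / 3"
      unfolding base_def zK a by (simp add: field_simps power2_eq_square power3_eq_cube)
    show "z + a / 2 = (P - p)\<^sup>2 / 2 + (P - p) * (p + q) + (p - q) * (p + q) / 2
      + (P - p + (p - q)) * (1 - P - q) + - 1 * (1 - P - q)\<^sup>2 / 2"
      unfolding zK a by (simp add: field_simps power2_eq_square power3_eq_cube)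
  qed (use pq a in auto)
  ultimately show ?thesis by simp
qed

text \<open>The optimal path separates the rectangle, of height \<open>Q\<close>, into two trapezoids; \<open>n\<close> is the mean width of one
  of them and \<open>d\<close> the difference of its parallel sides.\<close>

lemma least_v_min_plus:
  assumes f: "feasible a z w" and w: "w \<le> - w_mm (- a) (- z)"
  shows "least a z w (v_min_plus a z w)"
\<comment> \<open>For \<open>a = 1\<close> the rectangle has height 0 and the only path is X t = t;
  the general case divides by the height.\<close>
proof (cases "a = 1")
  case True
  then have "z = 0" using f by (simp add: feasible_def z_max_def)
  moreover have "w = - 1 / 3" using f by (simp add: feasible_def w_max_def True \<open>z = 0\<close>)
  ultimately show ?thesis unfolding True
    by (intro least_three_arcs[of 1 0 0 0 1]) (auto simp: v_min_plus_def)
next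
  case False
  define Q where "Q = (1 - a) / 2"
  have a: "a = 1 - 2 * Q" by (simp add: Q_def field_simps)
  have Q: "0 < Q" "Q \<le> 1" using f False by (auto simp: feasible_def Q_def)
  have zm: "\<bar>z\<bar> \<le> Q * (1 - Q)"
    using f by (simp add: feasible_def z_max_def a power2_eq_square algebra_simps)
  define R where "R = (1 - a) * (1 + 24 * w + 3 * a + 4 * a ^ 3) - 12 * (1 - a) * z - 12 * z\<^sup>2"
  define n where "n = (Q * (1 - Q) - z) / (2 * Q)"
  have n: "2 * Q * n = Q * (1 - Q) - z" using Q by (simp add: n_def)
  then have zn: "z = Q * (1 - Q) - 2 * Q * n" by simp
  \<comment> \<open>The radicand \<open>R\<close> will be the square of
    \<open>2 * Q * (d + Q)\<close>. The lower bound on \<open>w\<close> from feasibility therefore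
    amounts to \<open>d \<ge> 0\<close>.\<close>
  have "R - (2 * Q * Q)\<^sup>2 = 48 * Q * (w + w_max (- a) (- z))"
    using Q unfolding R_def w_max_def a
    by (simp add: divide_simps) (simp add: algebra_simps power2_eq_square power3_eq_cube power4_eq_xxxx)
  moreover have "0 \<le> 48 * Q * (w + w_max (- a) (- z))" using f Q by (simp add: feasible_def)
  ultimately have R1: "(2 * Q * Q)\<^sup>2 \<le> R" by linarith
  \<comment> \<open>The smaller of the mean widths \<open>n\<close> and \<open>1 - Q - n\<close> of
    the two trapezoids; which one it is depends on the sign of \<open>z\<close>, as in
    \<open>w_mm\<close>.\<close>
  define b where "b = (if z \<le> 0 then 1 - Q - n else n)"
  have b: "b \<le> n" "b \<le> 1 - Q - n"
  proof -
    have "Q * (2 * b) \<le> Q * (2 * n)" "Q * (2 * b) \<le> Q * (2 * (1 - Q - n))"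
      using zn by (auto simp: b_def algebra_simps)
    then show "b \<le> n" "b \<le> 1 - Q - n" using Q by simp_all
  qed
  have "0 \<le> 2 * Q * b" using zn zm by (auto simp: b_def algebra_simps abs_le_iff)
  then have b0: "0 \<le> b" using Q by (simp add: zero_le_mult_iff)
  \<comment> \<open>The assumed regime for \<open>w\<close> amounts to \<open>d \<le> 2 * b\<close>,
    so that neither outer arc has negative length.\<close>
  have "(2 * Q * (2 * b + Q))\<^sup>2 - R = 48 * Q * (- w_mm (- a) (- z) - w)"
  proof (cases "z \<le> 0")
    case True
    then have "2 * Q * (2 * b + Q) = 2 * (Q * (1 - Q) + z + Q * Q)"
      using zn by (simp add: b_def algebra_simps)
    then show ?thesis using Q True unfolding R_def w_mm_def a sg_def
      by (simp add: divide_simps) (simp add: algebra_simps power2_eq_square power3_eq_cube power4_eq_xxxx)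
  next
    case False
    then have "2 * Q * (2 * b + Q) = 2 * (Q * (1 - Q) - z + Q * Q)"
      using zn by (simp add: b_def algebra_simps)
    then show ?thesis using Q False unfolding R_def w_mm_def a sg_def
      by (simp add: divide_simps) (simp add: algebra_simps power2_eq_square power3_eq_cube power4_eq_xxxx)
  qed
  moreover have "0 \<le> 48 * Q * (- w_mm (- a) (- z) - w)" using w Q by simp
  ultimately have R2: "R \<le> (2 * Q * (2 * b + Q))\<^sup>2" by linarith
  define d where "d = sqrt R / (2 * Q) - Q"
  have sR: "sqrt R = 2 * Q * (d + Q)" using Q by (simp add: d_def)
  have "2 * Q * Q \<le> sqrt R" by (rule real_le_rsqrt[OF R1])
  then have d0: "0 \<le> d" using Q by (simp add: d_def field_simps)
  have "sqrt R \<le> 2 * Q * (2 * b + Q)" using R2 Q b0 by (intro real_le_lsqrt) auto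
  then have d1: "d \<le> 2 * b" unfolding sR using Q by simp
  have "R \<ge> 0" using R1 by (meson order_trans zero_le_power2)
  then have "R = (2 * Q * (d + Q))\<^sup>2" unfolding sR[symmetric] by simp
  then have "Q * (48 * w) = Q * (4 * Q * (d + Q)\<^sup>2 - 2 * (1 + 3 * a + 4 * a ^ 3) + 24 * z + 24 * z * (1 - Q - 2 * n) / 2)"
    unfolding R_def zn a by (simp add: field_simps power2_eq_square power3_eq_cube power4_eq_xxxx)
  then have wd: "w = (4 * Q * (d + Q)\<^sup>2 - 2 * (1 + 3 * a + 4 * a ^ 3) + 24 * z + 12 * z * (1 - Q - 2 * n)) / 48"
    using Q by simp
  show ?thesis
  proof (rule least_three_arcs[of "1 - Q - n - d / 2" "d + Q" "n - d / 2" "d - Q" 1])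
    show "z + a / 2 = (1 - Q - n - d / 2)\<^sup>2 / 2 + (1 - Q - n - d / 2) * (d + Q) + (d - Q) * (d + Q) / 2
      + (1 - Q - n - d / 2 + (d - Q)) * (n - d / 2) + 1 * (n - d / 2)\<^sup>2 / 2"
      unfolding zn a by (simp add: field_simps power2_eq_square power3_eq_cube power4_eq_xxxx)
    show "w + a ^ 3 / 6 + a / 2 = (1 - Q - n - d / 2) ^ 3 / 3
      + (1 - Q - n - d / 2)\<^sup>2 * (d + Q) + (1 - Q - n - d / 2) * (d + Q)\<^sup>2 / 2
      + (1 - Q - n - d / 2) * (d - Q) * (d + Q) / 2 + (d - Q) * (d + Q)\<^sup>2 / 3
      + (1 - Q - n - d / 2 + (d + Q)) * (1 - Q - n - d / 2 + (d - Q)) * (n - d / 2)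
      + (1 - Q - n - d / 2 + (d - Q)) * (n - d / 2)\<^sup>2 / 2
      + (1 - Q - n - d / 2 + (d + Q)) * 1 * (n - d / 2)\<^sup>2 / 2 + 1 * (n - d / 2) ^ 3 / 3"
      unfolding wd zn a by (simp add: field_simps power2_eq_square power3_eq_cube power4_eq_xxxx)
    show "2 * v_min_plus a z w - 1 / 3 = (1 - Q - n - d / 2) ^ 3 / 3 + (1 - Q - n - d / 2)\<^sup>2 * (d + Q)
      + (1 - Q - n - d / 2) * (d - Q) * (d + Q) + (d - Q)\<^sup>2 * (d + Q) / 3
      + (1 - Q - n - d / 2 + (d - Q))\<^sup>2 * (n - d / 2) + (1 - Q - n - d / 2 + (d - Q)) * 1 * (n - d / 2)\<^sup>2
      + (n - d / 2) ^ 3 / 3"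
      unfolding v_min_plus_def R_def[symmetric] sR unfolding wd zn a
      by (simp add: field_simps power2_eq_square power3_eq_cube power4_eq_xxxx)
  qed (use b b0 d0 d1 Q a in auto)
qed

lemma least_reflect: "least a z w v \<Longrightarrow> least (- a) (- z) (- w) v"
  unfolding least_def using reach_reflect[of a z w] reach_reflect[of "- a" "- z" "- w"] by auto

lemma least_v_min:
  assumes f: "feasible a z w"
  shows "least a z w (v_min a z w)"
proof -
  consider "w \<ge> w_mm a z" | "w < w_mm a z" "w \<le> - w_mm (- a) (- z)"
    | "w < w_mm a z" "- w_mm (- a) (- z) < w" "z \<ge> 0"
    | "w < w_mm a z" "- w_mm (- a) (- z) < w" "z < 0" by linarith
  then show ?thesis
  proof cases
    case 1
    then show ?thesis
      using least_reflect[OF least_v_min_plus[OF feasible_reflect[OF f]]] by (simp add: v_min_def)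
  next
    case 2
    then show ?thesis using least_v_min_plus[OF f] by (simp add: v_min_def)
  next
    case 3
    then show ?thesis using least_v_min_minus[OF f] by (simp add: v_min_def sg_def)
  next
    case 4
    then show ?thesis
      using least_reflect[OF least_v_min_minus[OF feasible_reflect[OF f]]] by (simp add: v_min_def sg_def)
  qed
qed

text \<open>Convex combinations of two paths keep the endpoint and the first two moments, while the
  integral of the square varies continuously with the parameter.\<close>

lemma reach_between:
  assumes "reach a z w v1" "reach a z w v2" "v1 \<le> v" "v \<le> v2"
  shows "reach a z w v"
proof -
  obtain u X where X: "steer u X" "X 1 = a"
    "moments X (z + a / 2) (w + a ^ 3 / 6 + a / 2) (2 * v1 - 1 / 3)"
    using assms(1) by (auto simp: reach_def)
  obtain u' Y where Y: "steer u' Y" "Y 1 = a"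
    "moments Y (z + a / 2) (w + a ^ 3 / 6 + a / 2) (2 * v2 - 1 / 3)"
    using assms(2) by (auto simp: reach_def)
  have "continuous_on {0..1} (\<lambda>t. X t * Y t)"
    by (intro continuous_intros indef_continuous[OF steer_indef[OF X(1)]]
        indef_continuous[OF steer_indef[OF Y(1)]])
  then obtain c where c: "((\<lambda>t. X t * Y t) has_integral c) {0..1}"
    using integrable_continuous_real by blast
  \<comment> \<open>The integral of the square of the combination with weights 1 - k and k;
    \<open>c\<close> is the integral of the mixed product.\<close>
  define g where "g = (\<lambda>k. (1 - k)\<^sup>2 * (2 * v1 - 1 / 3) + 2 * k * (1 - k) * c + k\<^sup>2 * (2 * v2 - 1 / 3))"
  have "\<exists>k. 0 \<le> k \<and> k \<le> 1 \<and> g k = 2 * v - 1 / 3"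
    by (rule IVT') (use assms in \<open>auto simp: g_def intro!: continuous_intros\<close>)
  then obtain k where k: "0 \<le> k" "k \<le> 1" "g k = 2 * v - 1 / 3" by blast
  define U where "U = (\<lambda>t. (1 - k) * u t + k * u' t)"
  define Z where "Z = (\<lambda>t. (1 - k) * X t + k * Y t)"
  have "indef U Z"
    unfolding U_def Z_def by (intro indef_add indef_cmult steer_indef X Y)
  moreover have "\<bar>U t\<bar> \<le> 1" if "t \<in> {0..1}" for t
  proof -
    have "\<bar>u t\<bar> \<le> 1" "\<bar>u' t\<bar> \<le> 1" using X(1) Y(1) that by (auto simp: steer_def)
    then have "(1 - k) * \<bar>u t\<bar> \<le> (1 - k) * 1" "k * \<bar>u' t\<bar> \<le> k * 1"
      using k by (intro mult_left_mono; simp)+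
    then have "\<bar>(1 - k) * u t\<bar> \<le> 1 - k" "\<bar>k * u' t\<bar> \<le> k"
      using k by (simp_all add: abs_mult)
    then show ?thesis unfolding U_def by linarith
  qed
  ultimately have "steer U Z" by (simp add: steer_def)
  moreover have "Z 1 = a" using X(2) Y(2) by (simp add: Z_def algebra_simps)
  moreover have "moments Z (z + a / 2) (w + a ^ 3 / 6 + a / 2) (2 * v - 1 / 3)"
  proof -
    have conv: "(1 - k) * r + k * r = r" for r :: real by (simp add: algebra_simps)
    have "(Z has_integral ((1 - k) * (z + a / 2) + k * (z + a / 2))) {0..1}"
      unfolding Z_def using X(3) Y(3) unfolding moments_def
      by (intro has_integral_add has_integral_mult_right) auto
    moreover have "((\<lambda>t. (1 - k) * (t * X t) + k * (t * Y t)) has_integral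
        ((1 - k) * (w + a ^ 3 / 6 + a / 2) + k * (w + a ^ 3 / 6 + a / 2))) {0..1}"
      using X(3) Y(3) unfolding moments_def
      by (intro has_integral_add has_integral_mult_right) auto
    moreover have "((\<lambda>t. (1 - k)\<^sup>2 * (X t)\<^sup>2 + 2 * k * (1 - k) * (X t * Y t) + k\<^sup>2 * (Y t)\<^sup>2)
        has_integral g k) {0..1}"
      unfolding g_def using X(3) Y(3) c unfolding moments_def
      by (intro has_integral_add has_integral_mult_right) auto
    ultimately show ?thesis
      unfolding moments_def k(3)[symmetric] conv Z_def
      by (simp add: algebra_simps power2_eq_square)
  qed
  ultimately show ?thesis unfolding reach_def by blast
qed

theorem reach_iff:
  "reach a z w v \<longleftrightarrow> feasible a z w \<and> v_min a z w \<le> v \<and> v \<le> v_max a z w"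
  using reach_feasible[of a z w v] least_v_min[of a z w] reach_v_le[of a z w v] reach_v_max[of a z w]
    reach_between[of a z w "v_min a z w" "v_max a z w" v]
  unfolding least_def by blast

section \<open>Trajectories and symmetries\<close>

lemma has_integral_Pair_iff:
  fixes f :: "real \<Rightarrow> 'a::euclidean_space" and g :: "real \<Rightarrow> 'b::euclidean_space"
  shows "((\<lambda>t. (f t, g t)) has_integral (a, b)) S \<longleftrightarrow> (f has_integral a) S \<and> (g has_integral b) S"
proof
  assume h: "((\<lambda>t. (f t, g t)) has_integral (a, b)) S"
  show "(f has_integral a) S \<and> (g has_integral b) S"
    using has_integral_linear[OF h bounded_linear_fst] has_integral_linear[OF h bounded_linear_snd]
    by (simp add: o_def)
next
  assume "(f has_integral a) S \<and> (g has_integral b) S"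
  then have f: "(f has_integral a) S" and g: "(g has_integral b) S" by auto
  have "bounded_linear (\<lambda>x::'a. (x, 0::'b))" "bounded_linear (\<lambda>x::'b. (0::'a, x))"
    by (intro bounded_linear_Pair bounded_linear_ident bounded_linear_zero)+
  from has_integral_add[OF has_integral_linear[OF f this(1)] has_integral_linear[OF g this(2)]]
  show "((\<lambda>t. (f t, g t)) has_integral (a, b)) S" by (simp add: o_def)
qed

lemma trajectory_iff:
  "trajectory T u1 u2 (\<lambda>t. (x t, y t, z t, v t, w t)) \<longleftrightarrow>
    continuous_on {0..T} (\<lambda>t. (x t, y t, z t, v t, w t)) \<and>
    (\<forall>t\<in>{0..T}. (u1 has_integral x t) {0..t} \<and> (u2 has_integral y t) {0..t} \<and>
      ((\<lambda>s. u2 s * (x s / 2) - u1 s * (y s / 2)) has_integral z t) {0..t} \<and>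
      ((\<lambda>s. u2 s * (((x s)\<^sup>2 + (y s)\<^sup>2) / 2)) has_integral v t) {0..t} \<and>
      ((\<lambda>s. - (u1 s * (((x s)\<^sup>2 + (y s)\<^sup>2) / 2))) has_integral w t) {0..t})"
  by (simp add: trajectory_def q0_def has_integral_Pair_iff)

lemma cartan_components:
  fixes q :: "real \<Rightarrow> cartan"
  obtains x y z v w where "q = (\<lambda>t. (x t, y t, z t, v t, w t))"
proof -
  have "q = (\<lambda>t. (fst (q t), fst (snd (q t)), fst (snd (snd (q t))), fst (snd (snd (snd (q t)))),
    snd (snd (snd (snd (q t))))))" by simp
  then show ?thesis by (rule that)
qed

text \<open>The first two components of the integral equation exhibit the controls as integrable
  functions. This recovers admissibility for points of \<open>attainable_u2\<close>, which is
  defined through trajectories.\<close>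

lemma trajectory_controls_measurable:
  assumes "trajectory T u1 u2 q" "T \<ge> 0"
  shows "u1 \<in> borel_measurable (lebesgue_on {0..T})" "u2 \<in> borel_measurable (lebesgue_on {0..T})"
proof -
  obtain x y z v w where q: "q = (\<lambda>t. (x t, y t, z t, v t, w t))" using cartan_components .
  have "(u1 has_integral x T) {0..T}" "(u2 has_integral y T) {0..T}"
    using assms unfolding q trajectory_iff by auto
  then show "u1 \<in> borel_measurable (lebesgue_on {0..T})" "u2 \<in> borel_measurable (lebesgue_on {0..T})"
    by (auto intro!: integrable_imp_measurable)
qed

text \<open>A linear map that carries the fields into each other with transformed controls maps
  trajectories to trajectories, after the time change t = c s. Swap and dilation are both
  instances.\<close>

lemma trajectory_transform:
  assumes tr: "trajectory (c * T) u1 u2 q" and c: "c > 0" and L: "bounded_linear L"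
    and eq: "\<And>s p. c *\<^sub>R L (u1 (c * s) *\<^sub>R X1 p + u2 (c * s) *\<^sub>R X2 p)
      = v1 s *\<^sub>R X1 (L p) + v2 s *\<^sub>R X2 (L p)"
  shows "trajectory T v1 v2 (\<lambda>s. L (q (c * s)))"
  unfolding trajectory_def
proof (intro conjI ballI)
  interpret L: bounded_linear L by (rule L)
  have q0: "q0 = 0" by (simp add: q0_def zero_prod_def)
  have "continuous_on {0..c * T} q" using tr by (simp add: trajectory_def)
  moreover have "(\<lambda>s. c * s) ` {0..T} \<subseteq> {0..c * T}" using c by auto
  ultimately have "continuous_on {0..T} (\<lambda>s. q (c * s))"
    by (intro continuous_on_compose2[of _ q _ "\<lambda>s. c * s"] continuous_intros)
  then show "continuous_on {0..T} (\<lambda>s. L (q (c * s)))"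
    by (rule L.continuous_on)
  fix t assume t: "t \<in> {0..T}"
  let ?f = "\<lambda>s. u1 s *\<^sub>R X1 (q s) + u2 s *\<^sub>R X2 (q s)"
  have "(?f has_integral (q (c * t) - q0)) {0..c * t}"
    using tr t c by (auto simp: trajectory_def)
  from has_integral_stretch_real[OF has_integral_linear[OF this L], of c]
  have "((\<lambda>s. L (?f (c * s))) has_integral (1 / c) *\<^sub>R L (q (c * t))) {0..t}"
    using c t by (simp add: o_def q0 image_divide_atLeastAtMost)
  from has_integral_cmul[OF this, of c]
  have "((\<lambda>s. c *\<^sub>R L (?f (c * s))) has_integral L (q (c * t))) {0..t}" using c by simp
  then show "((\<lambda>s. v1 s *\<^sub>R X1 (L (q (c * s))) + v2 s *\<^sub>R X2 (L (q (c * s)))) has_integral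
      L (q (c * t)) - q0) {0..t}"
    unfolding eq by (simp add: q0)
qed

section \<open>Reduction to T = 1 and second control 1\<close>

definition attainable_u2 :: "real \<Rightarrow> real \<Rightarrow> cartan set" where
  "attainable_u2 T \<sigma> = {q T | q u1 u2. trajectory T u1 u2 q \<and> (\<forall>t\<in>{0..T}. \<bar>u1 t\<bar> \<le> 1 \<and> u2 t = \<sigma>)}"

lemma attainable_u2I:
  assumes "trajectory T u1 u2 q" "\<And>t. t \<in> {0..T} \<Longrightarrow> \<bar>u1 t\<bar> \<le> 1" "\<And>t. t \<in> {0..T} \<Longrightarrow> u2 t = \<sigma>"
  shows "q T \<in> attainable_u2 T \<sigma>"
  unfolding attainable_u2_def
  by (rule CollectI, rule exI[of _ q], rule exI[of _ u1], rule exI[of _ u2]) (simp add: assms)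

lemma attainable_singI:
  assumes "admissible_control T u1 u2" "singular_control T u1 u2" "trajectory T u1 u2 q"
  shows "q T \<in> attainable_sing T"
  unfolding attainable_sing_def
  by (rule CollectI, rule exI[of _ q], rule exI[of _ u1], rule exI[of _ u2]) (simp add: assms)

text \<open>The linear involution that exchanges the two vector fields.\<close>

fun swap :: "cartan \<Rightarrow> cartan" where
  "swap (x, y, z, v, w) = (y, x, - z, - w, - v)"

text \<open>The group dilation with weights 1, 1, 2, 3, 3, combined for
  \<open>\<sigma> = - 1\<close> with the symmetry that reverses y and the second control.\<close>

fun dilate :: "real \<Rightarrow> real \<Rightarrow> cartan \<Rightarrow> cartan" where
  "dilate r \<sigma> (x, y, z, v, w) = (r * x, \<sigma> * r * y, \<sigma> * r\<^sup>2 * z, \<sigma> * r ^ 3 * v, r ^ 3 * w)"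

lemma linear_swap: "bounded_linear swap"
  by (rule linear_conv_bounded_linear[THEN iffD1], rule linearI) (auto simp: algebra_simps)

lemma linear_dilate: "bounded_linear (dilate r \<sigma>)"
  by (rule linear_conv_bounded_linear[THEN iffD1], rule linearI) (auto simp: algebra_simps)

lemma trajectory_swap:
  assumes "trajectory T u1 u2 q"
  shows "trajectory T u2 u1 (\<lambda>t. swap (q t))"
proof -
  have "trajectory T u2 u1 (\<lambda>t. swap (q (1 * t)))"
  proof (rule trajectory_transform[OF _ _ linear_swap])
    show "1 *\<^sub>R swap (u1 (1 * s) *\<^sub>R X1 p + u2 (1 * s) *\<^sub>R X2 p)
      = u2 s *\<^sub>R X1 (swap p) + u1 s *\<^sub>R X2 (swap p)" for s p
      by (cases p) (simp add: algebra_simps)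
  qed (use assms in auto)
  then show ?thesis by simp
qed

lemma dilate_attainable_u2:
  assumes p: "p \<in> attainable_u2 (c * T) \<sigma>" and c: "c > 0" and T: "T \<ge> 0" and \<tau>: "\<tau>\<^sup>2 = 1"
  shows "dilate (1 / c) \<tau> p \<in> attainable_u2 T (\<tau> * \<sigma>)"
proof -
  obtain q u1 u2 where q: "p = q (c * T)" "trajectory (c * T) u1 u2 q"
    "\<forall>t\<in>{0..c * T}. \<bar>u1 t\<bar> \<le> 1 \<and> u2 t = \<sigma>"
    using p by (auto simp: attainable_u2_def)
  have tr: "trajectory T (\<lambda>s. u1 (c * s)) (\<lambda>s. \<tau> * u2 (c * s)) (\<lambda>s. dilate (1 / c) \<tau> (q (c * s)))"
  proof (rule trajectory_transform[OF q(2) c linear_dilate])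
    fix s p
    show "c *\<^sub>R dilate (1 / c) \<tau> (u1 (c * s) *\<^sub>R X1 p + u2 (c * s) *\<^sub>R X2 p)
      = u1 (c * s) *\<^sub>R X1 (dilate (1 / c) \<tau> p) + (\<tau> * u2 (c * s)) *\<^sub>R X2 (dilate (1 / c) \<tau> p)"
      using c \<tau> by (cases p) (simp add: field_simps power2_eq_square power3_eq_cube)
  qed
  have "c * t \<in> {0..c * T}" if "t \<in> {0..T}" for t using that c by simp
  then show ?thesis
    unfolding q(1) using q(3) by (intro attainable_u2I[OF tr]) auto
qed

lemma attainable_u2_normalize:
  assumes T: "T > 0" and \<sigma>: "\<sigma>\<^sup>2 = 1"
  shows "p \<in> attainable_u2 T \<sigma> \<longleftrightarrow> dilate (1 / T) \<sigma> p \<in> attainable_u2 1 1"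
proof
  assume "p \<in> attainable_u2 T \<sigma>"
  then show "dilate (1 / T) \<sigma> p \<in> attainable_u2 1 1"
    using dilate_attainable_u2[of p T 1 \<sigma> \<sigma>] assms by (simp add: power2_eq_square)
next
  assume "dilate (1 / T) \<sigma> p \<in> attainable_u2 1 1"
  then have "dilate (1 / (1 / T)) \<sigma> (dilate (1 / T) \<sigma> p) \<in> attainable_u2 T (\<sigma> * 1)"
    using assms by (intro dilate_attainable_u2) auto
  moreover have "dilate (1 / (1 / T)) \<sigma> (dilate (1 / T) \<sigma> p) = p"
    using assms by (cases p) (simp add: field_simps power2_eq_square)
  ultimately show "p \<in> attainable_u2 T \<sigma>" by simp
qed

section \<open>Trajectories versus moments of the first coordinate\<close>

lemma endpoint_integrals:
  assumes u: "steer u X" "X 1 = a"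
    and m: "moments X (z + a / 2) (w + a ^ 3 / 6 + a / 2) (2 * v - 1 / 3)"
  shows "((\<lambda>s. X s / 2 - u s * (s / 2)) has_integral z) {0..1}"
    and "((\<lambda>s. ((X s)\<^sup>2 + s\<^sup>2) / 2) has_integral v) {0..1}"
    and "((\<lambda>s. - (u s * (((X s)\<^sup>2 + s\<^sup>2) / 2))) has_integral w) {0..1}"
proof -
  have eq: "(f has_integral i) {0..1} \<Longrightarrow> (\<And>t. f t = g t) \<Longrightarrow> i = j \<Longrightarrow> (g has_integral j) {0..1}"
    for f g :: "real \<Rightarrow> real" and i j
    by (metis ext)
  note q = has_integral_quadratic[OF u(1) m, unfolded u(2)]
  show "((\<lambda>s. X s / 2 - u s * (s / 2)) has_integral z) {0..1}"
    by (rule eq[OF q[of 0 0 0 "1 / 2" 0 0 0 "- 1 / 2" 0 0 0 0]]) (simp_all add: field_simps)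
  show "((\<lambda>s. ((X s)\<^sup>2 + s\<^sup>2) / 2) has_integral v) {0..1}"
    by (rule eq[OF q[of 0 0 "1 / 2" 0 0 "1 / 2" 0 0 0 0 0 0]]) (simp_all add: field_simps)
  show "((\<lambda>s. - (u s * (((X s)\<^sup>2 + s\<^sup>2) / 2))) has_integral w) {0..1}"
    by (rule eq[OF q[of 0 0 0 0 0 0 0 0 "- 1 / 2" 0 0 "- 1 / 2"]]) (simp_all add: field_simps)
qed

lemma attainable_u2_imp_reach:
  assumes "p \<in> attainable_u2 1 1"
  shows "\<exists>a z v w. p = (a, 1, z, v, w) \<and> reach a z w v"
proof -
  obtain q u1 u2 where q: "p = q 1" "trajectory 1 u1 u2 q"
    and u: "\<And>t. t \<in> {0..1} \<Longrightarrow> \<bar>u1 t\<bar> \<le> 1 \<and> u2 t = 1"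
    using assms by (auto simp: attainable_u2_def)
  obtain X y z v w where q': "q = (\<lambda>t. (X t, y t, z t, v t, w t))" using cartan_components .
  have i: "(u1 has_integral X t) {0..t}" "(u2 has_integral y t) {0..t}"
      "((\<lambda>s. u2 s * (X s / 2) - u1 s * (y s / 2)) has_integral z t) {0..t}"
      "((\<lambda>s. u2 s * (((X s)\<^sup>2 + (y s)\<^sup>2) / 2)) has_integral v t) {0..t}"
      "((\<lambda>s. - (u1 s * (((X s)\<^sup>2 + (y s)\<^sup>2) / 2))) has_integral w t) {0..t}" if "t \<in> {0..1}" for t
    using q(2) that unfolding q' trajectory_iff by auto
  have y: "y t = t" if t: "t \<in> {0..1}" for t
  proof -
    have "((\<lambda>_. 1) has_integral y t) {0..t}"
      by (rule has_integral_eq[OF _ i(2)[OF t]]) (use u t in auto)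
    moreover have "((\<lambda>_. 1) has_integral t) {0..t}" using indefD[OF indef_id, of t] t by simp
    ultimately show ?thesis by (rule has_integral_unique)
  qed
  have X: "steer u1 X"
    unfolding steer_def indef_def using i(1) u by (intro conjI exI[of _ 1]) simp_all
  have c: "continuous_on {0..1} X" by (rule indef_continuous[OF steer_indef[OF X]])
  have "X integrable_on {0..1}" "(\<lambda>t. t * X t) integrable_on {0..1}" "(\<lambda>t. (X t)\<^sup>2) integrable_on {0..1}"
    by (intro integrable_continuous_real continuous_intros c)+
  then obtain A B C where "(X has_integral A) {0..1}" "((\<lambda>t. t * X t) has_integral B) {0..1}"
    "((\<lambda>t. (X t)\<^sup>2) has_integral C) {0..1}" by (elim integrable_on_def[THEN iffD1, elim_format] exE)
  then have "moments X A B C" by (simp add: moments_def)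
  \<comment> \<open>The candidate endpoint is obtained by solving the relations in
    \<open>reach\<close> for the coordinates; uniqueness of the integral identifies it with the true
    one.\<close>
  define Z V W where "Z = A - X 1 / 2" and "V = C / 2 + 1 / 6" and "W = B - X 1 ^ 3 / 6 - X 1 / 2"
  have m: "moments X (Z + X 1 / 2) (W + X 1 ^ 3 / 6 + X 1 / 2) (2 * V - 1 / 3)"
    using \<open>moments X A B C\<close> by (simp add: Z_def V_def W_def field_simps)
  note e = endpoint_integrals[OF X refl m]
  have "((\<lambda>s. X s / 2 - u1 s * (s / 2)) has_integral z 1) {0..1}"
    by (rule has_integral_eq[OF _ i(3)]) (use u y in auto)
  then have "z 1 = Z" using e(1) by (rule has_integral_unique)
  moreover have "((\<lambda>s. ((X s)\<^sup>2 + s\<^sup>2) / 2) has_integral v 1) {0..1}"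
    by (rule has_integral_eq[OF _ i(4)]) (use u y in auto)
  then have "v 1 = V" using e(2) by (rule has_integral_unique)
  moreover have "((\<lambda>s. - (u1 s * (((X s)\<^sup>2 + s\<^sup>2) / 2))) has_integral w 1) {0..1}"
    by (rule has_integral_eq[OF _ i(5)]) (use u y in auto)
  then have "w 1 = W" using e(3) by (rule has_integral_unique)
  moreover have "reach (X 1) Z W V" unfolding reach_def using X m by blast
  ultimately show ?thesis using q(1) y[of 1] by (simp add: q')
qed

text \<open>\<open>reach\<close> prescribes the integrals at time 1 only, whereas a trajectory
  carries them at all times. They are built as indefinite integrals and then compared at time
  1.\<close>

lemma reach_imp_attainable_u2:
  assumes "reach a z w v"
  shows "(a, 1, z, v, w) \<in> attainable_u2 1 1"
proof -
  obtain u X where u: "steer u X" "X 1 = a"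
    and m: "moments X (z + a / 2) (w + a ^ 3 / 6 + a / 2) (2 * v - 1 / 3)"
    using assms by (auto simp: reach_def)
  note e = endpoint_integrals[OF u m]
  note c = indef_continuous[OF steer_indef[OF u(1)]]
  have c1: "continuous_on {0..1} (\<lambda>t. X t / 2)" and c2: "continuous_on {0..1} (\<lambda>t::real. t / 2)"
    and c3: "continuous_on {0..1} (\<lambda>s. ((X s)\<^sup>2 + s\<^sup>2) / 2)"
    by (intro continuous_intros c; simp)+
  obtain H1 where H1: "indef (\<lambda>t. X t / 2) H1" using indef_continuous_fun[OF c1] .
  obtain H2 where H2: "indef (\<lambda>t. u t * (t / 2)) H2"
    using indef_mult_continuous[OF steer_indef[OF u(1)] c2] .
  obtain V where V: "indef (\<lambda>s. ((X s)\<^sup>2 + s\<^sup>2) / 2) V" using indef_continuous_fun[OF c3] .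
  obtain H4 where H4: "indef (\<lambda>s. u s * (((X s)\<^sup>2 + s\<^sup>2) / 2)) H4"
    using indef_mult_continuous[OF steer_indef[OF u(1)] c3] .
  define Z where "Z = (\<lambda>t. H1 t + - 1 * H2 t)"
  define W where "W = (\<lambda>t. - 1 * H4 t)"
  have Z: "indef (\<lambda>s. X s / 2 - u s * (s / 2)) Z"
    using indef_add[OF H1 indef_cmult[OF H2, of "- 1"]] by (simp add: Z_def)
  have W: "indef (\<lambda>s. - (u s * (((X s)\<^sup>2 + s\<^sup>2) / 2))) W"
    using indef_cmult[OF H4, of "- 1"] by (simp add: W_def)
  have "trajectory 1 u (\<lambda>_. 1) (\<lambda>t. (X t, t, Z t, V t, W t))"
    unfolding trajectory_iff
  proof (intro conjI ballI)
    show "continuous_on {0..1} (\<lambda>t. (X t, t, Z t, V t, W t))"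
      by (intro continuous_intros c indef_continuous[OF Z] indef_continuous[OF V] indef_continuous[OF W])
  qed (use indefD[OF steer_indef[OF u(1)]] indefD[OF indef_id] indefD[OF Z] indefD[OF V] indefD[OF W]
    in \<open>simp_all\<close>)
  then have "(X 1, 1, Z 1, V 1, W 1) \<in> attainable_u2 1 1"
    by (rule attainable_u2I[where q = "\<lambda>t. (X t, t, Z t, V t, W t)"])
      (use u(1) in \<open>simp_all add: steer_def\<close>)
  moreover have "Z 1 = z" by (rule has_integral_unique[OF indefD[OF Z] e(1)]) simp_all
  moreover have "V 1 = v" by (rule has_integral_unique[OF indefD[OF V] e(2)]) simp_all
  moreover have "W 1 = w" by (rule has_integral_unique[OF indefD[OF W] e(3)]) simp_all
  ultimately show ?thesis using u(2) by simp
qed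

lemma attainable_u2_reach:
  assumes "T > 0" "\<sigma>\<^sup>2 = 1"
  shows "(x, y, z, v, w) \<in> attainable_u2 T \<sigma> \<longleftrightarrow>
    y = \<sigma> * T \<and> reach (x / T) (\<sigma> * z / T\<^sup>2) (w / T ^ 3) (\<sigma> * v / T ^ 3)"
proof -
  have "y = \<sigma> * T \<longleftrightarrow> \<sigma> * y / T = 1"
    using assms by (auto simp: field_simps power2_eq_square)
  moreover have "dilate (1 / T) \<sigma> (x, y, z, v, w) =
      (x / T, \<sigma> * y / T, \<sigma> * z / T\<^sup>2, \<sigma> * v / T ^ 3, w / T ^ 3)"
    by (simp add: power_divide)
  ultimately show ?thesis
    unfolding attainable_u2_normalize[OF assms]
    using attainable_u2_imp_reach reach_imp_attainable_u2 by fastforce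
qed

text \<open>Either control may be the constant one; \<open>swap\<close> turns a constant first
  control into a constant second one.\<close>

lemma attainable_sing_eq:
  assumes "T > 0"
  shows "p \<in> attainable_sing T \<longleftrightarrow>
    (\<exists>\<sigma>\<in>{1, - 1}. p \<in> attainable_u2 T \<sigma> \<or> swap p \<in> attainable_u2 T \<sigma>)"
proof
  assume "p \<in> attainable_sing T"
  then obtain q u1 u2 where q: "p = q T" "admissible_control T u1 u2" "singular_control T u1 u2"
    "trajectory T u1 u2 q" by (auto simp: attainable_sing_def)
  have b: "\<bar>u1 t\<bar> \<le> 1" "\<bar>u2 t\<bar> \<le> 1" if "t \<in> {0..T}" for t
    using q(2) that by (auto simp: admissible_control_def)
  obtain \<sigma> where \<sigma>: "\<sigma> \<in> {1, - 1}" "(\<forall>t\<in>{0..T}. u1 t = \<sigma>) \<or> (\<forall>t\<in>{0..T}. u2 t = \<sigma>)"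
    using q(3) by (auto simp: singular_control_def)
  from \<sigma>(2) have "p \<in> attainable_u2 T \<sigma> \<or> swap p \<in> attainable_u2 T \<sigma>"
  proof
    assume "\<forall>t\<in>{0..T}. u1 t = \<sigma>"
    then have "swap p \<in> attainable_u2 T \<sigma>"
      unfolding q(1) using b by (intro attainable_u2I[OF trajectory_swap[OF q(4)]]) auto
    then show ?thesis ..
  next
    assume "\<forall>t\<in>{0..T}. u2 t = \<sigma>"
    then have "p \<in> attainable_u2 T \<sigma>"
      unfolding q(1) using b by (intro attainable_u2I[OF q(4)]) auto
    then show ?thesis ..
  qed
  then show "\<exists>\<sigma>\<in>{1, - 1}. p \<in> attainable_u2 T \<sigma> \<or> swap p \<in> attainable_u2 T \<sigma>" using \<sigma>(1) by blast
next
  have swap2: "swap (swap p) = p" by (cases p) simp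
  assume "\<exists>\<sigma>\<in>{1, - 1}. p \<in> attainable_u2 T \<sigma> \<or> swap p \<in> attainable_u2 T \<sigma>"
  then obtain \<sigma> where \<sigma>: "\<sigma> = 1 \<or> \<sigma> = - 1" and "p \<in> attainable_u2 T \<sigma> \<or> swap p \<in> attainable_u2 T \<sigma>"
    by blast
  then show "p \<in> attainable_sing T"
  proof (elim disjE[of "p \<in> attainable_u2 T \<sigma>"])
    assume "p \<in> attainable_u2 T \<sigma>"
    then obtain q u1 u2 where q: "p = q T" "trajectory T u1 u2 q"
      "\<forall>t\<in>{0..T}. \<bar>u1 t\<bar> \<le> 1 \<and> u2 t = \<sigma>" by (auto simp: attainable_u2_def)
    have "admissible_control T u1 u2" "singular_control T u1 u2"
      using trajectory_controls_measurable[OF q(2)] assms q(3) \<sigma>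
      by (auto simp: admissible_control_def singular_control_def)
    then show ?thesis unfolding q(1) by (rule attainable_singI[OF _ _ q(2)])
  next
    assume "swap p \<in> attainable_u2 T \<sigma>"
    then obtain q u1 u2 where q: "swap p = q T" "trajectory T u1 u2 q"
      "\<forall>t\<in>{0..T}. \<bar>u1 t\<bar> \<le> 1 \<and> u2 t = \<sigma>" by (auto simp: attainable_u2_def)
    have "admissible_control T u2 u1" "singular_control T u2 u1"
      using trajectory_controls_measurable[OF q(2)] assms q(3) \<sigma>
      by (auto simp: admissible_control_def singular_control_def)
    then have "swap (q T) \<in> attainable_sing T" by (rule attainable_singI[OF _ _ trajectory_swap[OF q(2)]])
    then show ?thesis using q(1) swap2 by metis
  qed
qed

text \<open>Since y = \<open>\<sigma> * T\<close>, the sign \<open>\<sigma>\<close> is y / T. The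
  normalized coordinate \<open>\<sigma> * z / T\<^sup>2\<close> is therefore
  \<open>y * z / T ^ 3\<close>, and one formula covers both signs.\<close>

lemma attainable_u2_iff:
  assumes T: "T > 0"
  shows "(\<exists>\<sigma>\<in>{1, - 1}. (x, y, z, v, w) \<in> attainable_u2 T \<sigma>) \<longleftrightarrow>
    \<bar>x * y\<bar> \<le> T\<^sup>2 \<and> \<bar>z\<bar> \<le> T\<^sup>2 * z_max (x * y / T\<^sup>2) \<and> \<bar>y\<bar> = T \<and>
    - (T ^ 3 * w_max (- (x / T)) (- (y * z / T ^ 3))) \<le> w \<and>
    w \<le> T ^ 3 * w_max (x / T) (y * z / T ^ 3) \<and>
    T ^ 3 * v_min (x / T) (y * z / T ^ 3) (w / T ^ 3) \<le> y * v / T \<and>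
    y * v / T \<le> T ^ 3 * v_max (x / T) (y * z / T ^ 3) (w / T ^ 3)" (is "?L \<longleftrightarrow> ?R")
proof -
  have main: "?R \<longleftrightarrow> reach (x / T) (\<sigma> * z / T\<^sup>2) (w / T ^ 3) (\<sigma> * v / T ^ 3)"
    if y: "y = \<sigma> * T" and \<sigma>: "\<sigma> \<in> {1, - 1}" for \<sigma>
  proof -
    have s: "\<bar>\<sigma>\<bar> = 1" "\<sigma>\<^sup>2 = 1" using \<sigma> by auto
    have "\<bar>x * y\<bar> \<le> T\<^sup>2 \<longleftrightarrow> \<bar>x / T\<bar> \<le> 1"
      using T s by (simp add: y abs_mult power2_eq_square divide_simps)
    moreover have "z_max (x * y / T\<^sup>2) = z_max (x / T)"
      using T s by (simp add: z_max_def y power2_eq_square power_mult_distrib field_simps)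
    then have "\<bar>z\<bar> \<le> T\<^sup>2 * z_max (x * y / T\<^sup>2) \<longleftrightarrow> \<bar>\<sigma> * z / T\<^sup>2\<bar> \<le> z_max (x / T)"
      using T s by (simp add: abs_mult divide_simps mult.commute)
    moreover have "\<bar>y\<bar> = T" using T s by (simp add: y abs_mult)
    moreover have yz: "y * z / T ^ 3 = \<sigma> * z / T\<^sup>2"
      using T by (simp add: y power2_eq_square power3_eq_cube)
    moreover have yv: "y * v / T = \<sigma> * v" using T by (simp add: y)
    moreover have "- (T ^ 3 * c) \<le> b \<longleftrightarrow> - c \<le> b / T ^ 3" "b \<le> T ^ 3 * c \<longleftrightarrow> b / T ^ 3 \<le> c"
      "T ^ 3 * c \<le> b \<longleftrightarrow> c \<le> b / T ^ 3" for b c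
      using T by (simp_all add: field_simps)
    ultimately show ?thesis unfolding reach_iff feasible_def by simp
  qed
  have sq: "\<sigma>\<^sup>2 = 1" if "\<sigma> \<in> {1, - 1}" for \<sigma> :: real using that by auto
  show ?thesis
  proof
    assume ?L
    then obtain \<sigma> where \<sigma>: "\<sigma> \<in> {1, - 1}" and p: "(x, y, z, v, w) \<in> attainable_u2 T \<sigma>" ..
    note r = iffD1[OF attainable_u2_reach[OF T sq[OF \<sigma>]] p]
    show ?R by (rule iffD2[OF main[OF conjunct1[OF r] \<sigma>] conjunct2[OF r]])
  next
    assume R: ?R
    have "\<bar>y\<bar> = T" by (rule R[THEN conjunct2, THEN conjunct2, THEN conjunct1])
    then have "y = 1 * T \<or> y = - 1 * T" by arith
    then obtain \<sigma> where \<sigma>: "\<sigma> \<in> {1, - 1}" and y: "y = \<sigma> * T" by blast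
    have "(x, y, z, v, w) \<in> attainable_u2 T \<sigma>"
      by (rule iffD2[OF attainable_u2_reach[OF T sq[OF \<sigma>]] conjI[OF y iffD1[OF main[OF y \<sigma>] R]]])
    then show ?L using \<sigma> ..
  qed
qed

text \<open>The arguments are divided by powers of \<open>T\<close> according to the weights of the
  dilation, and the sign of the constant control enters through \<open>y1 * z1\<close> or
  \<open>x1 * z1\<close>.\<close>

theorem corollary3:
  fixes T :: real
  assumes "T > 0"
  shows "attainable_sing T =
    {(x1, y1, z1, v1, w1).
       \<bar>x1 * y1\<bar> \<le> T\<^sup>2 \<and>
       \<bar>z1\<bar> \<le> T\<^sup>2 * z_max (x1 * y1 / T\<^sup>2) \<and>
       ((\<bar>y1\<bar> = T \<and>
         - (T ^ 3 * w_max (- (x1 / T)) (- (y1 * z1 / T ^ 3))) \<le> w1 \<and>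
         w1 \<le> T ^ 3 * w_max (x1 / T) (y1 * z1 / T ^ 3) \<and>
         T ^ 3 * v_min (x1 / T) (y1 * z1 / T ^ 3) (w1 / T ^ 3) \<le> y1 * v1 / T \<and>
         y1 * v1 / T \<le> T ^ 3 * v_max (x1 / T) (y1 * z1 / T ^ 3) (w1 / T ^ 3))
        \<or>
        (\<bar>x1\<bar> = T \<and>
         - (T ^ 3 * w_max (y1 / T) (- (x1 * z1 / T ^ 3))) \<le> v1 \<and>
         v1 \<le> T ^ 3 * w_max (- (y1 / T)) (x1 * z1 / T ^ 3) \<and>
         - (T ^ 3 * v_max (y1 / T) (- (x1 * z1 / T ^ 3)) (- (v1 / T ^ 3))) \<le> x1 * w1 / T \<and>
         x1 * w1 / T \<le> - (T ^ 3 * v_min (y1 / T) (- (x1 * z1 / T ^ 3)) (- (v1 / T ^ 3)))))}"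
    (is "_ = ?S")
proof (intro set_eqI)
  fix p :: cartan
  obtain x y z v w where p: "p = (x, y, z, v, w)" by (cases p) auto
  have "p \<in> attainable_sing T \<longleftrightarrow>
      (\<exists>\<sigma>\<in>{1, - 1}. (x, y, z, v, w) \<in> attainable_u2 T \<sigma>) \<or>
      (\<exists>\<sigma>\<in>{1, - 1}. (y, x, - z, - w, - v) \<in> attainable_u2 T \<sigma>)"
    unfolding attainable_sing_eq[OF assms] p swap.simps by (simp only: bex_disj_distrib)
  also have "\<dots> \<longleftrightarrow> p \<in> ?S"
  proof -
    \<comment> \<open>The second system is the first one at the swapped point, so only signs have to
      be moved across the inequalities.\<close>
    have neg: "- v \<le> b \<longleftrightarrow> - b \<le> v" "b \<le> - (x * w / T) \<longleftrightarrow> x * w / T \<le> - b"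
      "- (x * w / T) \<le> b \<longleftrightarrow> - b \<le> x * w / T" for b by linarith+
    show ?thesis
      unfolding attainable_u2_iff[OF assms] p
      by (simp add: mult.commute[of y x] neg) blast
  qed
  finally show "p \<in> attainable_sing T \<longleftrightarrow> p \<in> ?S" .
qed

end
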